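(* Let $(\lambda,\mu)\in{\sf Kostka}_r^{\mathbb Z}$. The canonical matrix $A(\lambda,\mu)$ is reducible if and only if the KGR graph $G(\lambda,\mu)$ has a conservative subtree.
   Context: ${\sf Kostka}_r^{\mathbb Z}$ is the set of pairs $(\lambda,\mu)$ of partitions with at most $r$ nonzero parts, $|\lambda|=|\mu|$, $\sum_{i\le t}\lambda_i\ge\sum_{i\le t}\mu_i$ for all $t$. $\lambda'$ is the conjugate partition. Canonical (Ryser) matrix $A(\lambda,\mu)$: let $s=\lambda_1$. Start with the $r\times s$ $\{0,1\}$-matrix whose row $i$ has $\mu_i$ ones in columns $1,\ldots,\mu_i$. For $j=s,s-1,\ldots,1$ in turn: looking only at columns $1,\ldots,j$ of the current matrix, choose $\lambda'_j$ rows, taking rows with the largest number of $1$'s in columns $1,\ldots,j$ and breaking ties by preferring rows further south; in each chosen row, move the rightmost $1$ among columns $1,\ldots,j$ to column $j$. The final matrix is $A(\lambda,\mu)$. $A(\lambda,\mu)$ is \emph{reducible} if there is a nontrivial subset $S$ of its columns (nonempty, not all) such that the sum of the columns in $S$ and the sum of the columns not in $S$ are both weakly decreasing nonnegative vectors. Define $A^*(\lambda,\mu)_{i,j}=A(\lambda,\mu)_{i,j}-A(\lambda,\mu)_{i+1,j}$ (with $A(\lambda,\mu)_{r+1,j}:=0$). KGR graph $G(\lambda,\mu)$: directed graph whose vertices are the positions of the nonzero entries of $A^*(\lambda,\mu)$, with arcs (I) (horizontal) from each $-1$ entry to the rightmost $1$ entry strictly to its left in the same row; (II) (vertical) from each $1$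 entry to the $-1$ entry in the same column, if one exists. A source is a vertex with no incoming arcs, a sink a vertex with no outgoing arcs; connectivity refers to the underlying undirected graph. A \emph{conservative subtree} of $G(\lambda,\mu)$ is a connected nontrivial subgraph $G'$ such that whenever a vertical arc appears in $G'$, all vertical arcs of $G(\lambda,\mu)$ in the same column appear in $G'$, and one of: (C.1) $G'$ is a connected component of $G(\lambda,\mu)$; (C.2) $G'$ has a unique sink, it is a $-1$ entry, one source of $G'$ is a $1$ entry in the same row as this sink, and all other sources of $G'$ are sources of $G(\lambda,\mu)$. *)

theory Defs
  imports "Graph_Theory.Graph_Theory"
begin

text \<open>
  All indices are shifted by one: parts of a partition, rows and columns of a matrix are
  numbered from 0. A partition with at most \<open>r\<close> nonzero parts is a function
  \<open>nat \<Rightarrow> nat\<close> padded with zeros, and an \<open>r \<times> s\<close> matrix is a function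
  \<open>nat \<Rightarrow> nat \<Rightarrow> int\<close> of which only the entries \<open>i < r\<close>, \<open>j < s\<close> matter.
\<close>

definition is_partition :: "nat \<Rightarrow> (nat \<Rightarrow> nat) \<Rightarrow> bool" where
  "is_partition r lam \<longleftrightarrow> antimono lam \<and> (\<forall>i\<ge>r. lam i = 0)"

definition Kostka :: "nat \<Rightarrow> ((nat \<Rightarrow> nat) \<times> (nat \<Rightarrow> nat)) set" where
  "Kostka r = {(lam, mu). is_partition r lam \<and> is_partition r mu
     \<and> (\<Sum>i<r. lam i) = (\<Sum>i<r. mu i)
     \<and> (\<forall>t. (\<Sum>i<t. lam i) \<ge> (\<Sum>i<t. mu i))}"

definition conjugate :: "(nat \<Rightarrow> nat) \<Rightarrow> nat \<Rightarrow> nat" where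
  "conjugate lam j = card {i. j < lam i}"


definition row_ones :: "(nat \<Rightarrow> nat \<Rightarrow> int) \<Rightarrow> nat \<Rightarrow> nat \<Rightarrow> nat set" where
  "row_ones M j i = {p. p \<le> j \<and> M i p = 1}"

definition row_before :: "(nat \<Rightarrow> nat \<Rightarrow> int) \<Rightarrow> nat \<Rightarrow> nat \<Rightarrow> nat \<Rightarrow> bool" where
  "row_before M j i i' \<longleftrightarrow> card (row_ones M j i') < card (row_ones M j i)
     \<or> (card (row_ones M j i) = card (row_ones M j i') \<and> i' < i)"

text \<open>The first \<open>k\<close> rows in the strict linear order \<open>row_before M j\<close>:\<close>

definition chosen_rows :: "nat \<Rightarrow> (nat \<Rightarrow> nat \<Rightarrow> int) \<Rightarrow> nat \<Rightarrow> nat \<Rightarrow> nat set" where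
  "chosen_rows r M j k = {i. i < r \<and> card {i'. i' < r \<and> row_before M j i' i} < k}"

text \<open>For pairs in \<open>Kostka r\<close> every chosen row has a 1 among the columns considered, so the
  maximum below is never taken over the empty set.\<close>

definition ryser_step ::
  "nat \<Rightarrow> (nat \<Rightarrow> nat) \<Rightarrow> nat \<Rightarrow> (nat \<Rightarrow> nat \<Rightarrow> int) \<Rightarrow> nat \<Rightarrow> nat \<Rightarrow> int" where
  "ryser_step r lam j M = (\<lambda>i. if i \<in> chosen_rows r M j (conjugate lam j)
     then (M i)(Max (row_ones M j i) := 0, j := 1) else M i)"

text \<open>\<open>ryser_iter r lam n\<close> treats the columns \<open>n - 1, \<dots>, 0\<close> in this order.\<close>

primrec ryser_iter ::
  "nat \<Rightarrow> (nat \<Rightarrow> nat) \<Rightarrow> nat \<Rightarrow> (nat \<Rightarrow> nat \<Rightarrow> int) \<Rightarrow> nat \<Rightarrow> nat \<Rightarrow> int" where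
  "ryser_iter r lam 0 M = M"
| "ryser_iter r lam (Suc j) M = ryser_iter r lam j (ryser_step r lam j M)"

definition canonical_matrix ::
  "nat \<Rightarrow> (nat \<Rightarrow> nat) \<Rightarrow> (nat \<Rightarrow> nat) \<Rightarrow> nat \<Rightarrow> nat \<Rightarrow> int" where
  "canonical_matrix r lam mu =
     ryser_iter r lam (lam 0) (\<lambda>i j. if i < r \<and> j < mu i then 1 else 0)"


definition decreasing_nonneg :: "nat \<Rightarrow> (nat \<Rightarrow> int) \<Rightarrow> bool" where
  "decreasing_nonneg r v \<longleftrightarrow> (\<forall>i<r. 0 \<le> v i) \<and> (\<forall>i. Suc i < r \<longrightarrow> v (Suc i) \<le> v i)"

definition reducible :: "nat \<Rightarrow> nat \<Rightarrow> (nat \<Rightarrow> nat \<Rightarrow> int) \<Rightarrow> bool" where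
  "reducible r s A \<longleftrightarrow> (\<exists>S. S \<subseteq> {..<s} \<and> S \<noteq> {} \<and> S \<noteq> {..<s}
     \<and> decreasing_nonneg r (\<lambda>i. \<Sum>j\<in>S. A i j)
     \<and> decreasing_nonneg r (\<lambda>i. \<Sum>j\<in>{..<s} - S. A i j))"


definition star_matrix ::
  "nat \<Rightarrow> (nat \<Rightarrow> nat) \<Rightarrow> (nat \<Rightarrow> nat) \<Rightarrow> nat \<Rightarrow> nat \<Rightarrow> int" where
  "star_matrix r lam mu i j = canonical_matrix r lam mu i j
     - (if Suc i < r then canonical_matrix r lam mu (Suc i) j else 0)"

definition kgr_verts :: "nat \<Rightarrow> (nat \<Rightarrow> nat) \<Rightarrow> (nat \<Rightarrow> nat) \<Rightarrow> (nat \<times> nat) set" where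
  "kgr_verts r lam mu = {(i, j). i < r \<and> j < lam 0 \<and> star_matrix r lam mu i j \<noteq> 0}"

definition horizontal_arcs ::
  "nat \<Rightarrow> (nat \<Rightarrow> nat) \<Rightarrow> (nat \<Rightarrow> nat) \<Rightarrow> ((nat \<times> nat) \<times> (nat \<times> nat)) set" where
  "horizontal_arcs r lam mu = {((i, j), (i, k)) | i j k.
     i < r \<and> j < lam 0 \<and> k < j
     \<and> star_matrix r lam mu i j = -1 \<and> star_matrix r lam mu i k = 1
     \<and> (\<forall>l. k < l \<and> l < j \<longrightarrow> star_matrix r lam mu i l \<noteq> 1)}"

definition vertical_arcs ::
  "nat \<Rightarrow> (nat \<Rightarrow> nat) \<Rightarrow> (nat \<Rightarrow> nat) \<Rightarrow> ((nat \<times> nat) \<times> (nat \<times> nat)) set" where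
  "vertical_arcs r lam mu = {((i, j), (i', j)) | i i' j.
     i < r \<and> i' < r \<and> j < lam 0
     \<and> star_matrix r lam mu i j = 1 \<and> star_matrix r lam mu i' j = -1}"

definition kgr_graph ::
  "nat \<Rightarrow> (nat \<Rightarrow> nat) \<Rightarrow> (nat \<Rightarrow> nat)
   \<Rightarrow> (nat \<times> nat, (nat \<times> nat) \<times> (nat \<times> nat)) pre_digraph" where
  "kgr_graph r lam mu = \<lparr> verts = kgr_verts r lam mu,
     arcs = horizontal_arcs r lam mu \<union> vertical_arcs r lam mu, tail = fst, head = snd \<rparr>"

definition source :: "('a, 'b) pre_digraph \<Rightarrow> 'a \<Rightarrow> bool" where
  "source G v \<longleftrightarrow> v \<in> verts G \<and> in_arcs G v = {}"

definition sink :: "('a, 'b) pre_digraph \<Rightarrow> 'a \<Rightarrow> bool" where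
  "sink G v \<longleftrightarrow> v \<in> verts G \<and> out_arcs G v = {}"

text \<open>\<open>connected\<close> is the library predicate for digraphs, i.e. connectedness of the underlying
  undirected graph. A nontrivial subgraph is nonempty and different from the whole graph, as
  for the subsets of columns in \<open>reducible\<close>; without properness the irreducible matrix of
  \<open>\<lambda> = \<mu> = (1)\<close> would have a conservative subtree.\<close>

definition conservative_subtree ::
  "nat \<Rightarrow> (nat \<Rightarrow> nat) \<Rightarrow> (nat \<Rightarrow> nat)
   \<Rightarrow> (nat \<times> nat, (nat \<times> nat) \<times> (nat \<times> nat)) pre_digraph \<Rightarrow> bool" where
  "conservative_subtree r lam mu H \<longleftrightarrow>
     (let G = kgr_graph r lam mu in
       subgraph H G \<and> connected H \<and> verts H \<noteq> {} \<and> H \<noteq> G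
       \<and> (\<forall>a \<in> arcs H \<inter> vertical_arcs r lam mu. \<forall>b \<in> vertical_arcs r lam mu.
            snd (tail G b) = snd (tail G a) \<longrightarrow> b \<in> arcs H)
       \<and> (pre_digraph.max_subgraph G connected H
          \<or> (\<exists>v. (\<forall>u. sink H u \<longleftrightarrow> u = v)
               \<and> star_matrix r lam mu (fst v) (snd v) = -1
               \<and> (\<exists>w. source H w \<and> star_matrix r lam mu (fst w) (snd w) = 1 \<and> fst w = fst v
                    \<and> (\<forall>u. source H u \<and> u \<noteq> w \<longrightarrow> source G u)))))"

end

theory Submission
  imports Defs
begin

text \<open>
  Write \<open>B\<close> for the matrix \<open>A\<^sup>*\<close>. A set \<open>S\<close> of columns reduces \<open>A\<close> iff all row sums of \<open>B\<close> over
  \<open>S\<close> and over its complement are nonnegative. Ryser's rule forces every column of \<open>B\<close> to have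
  at most one \<open>-1\<close> and at most two \<open>1\<close>s, and the nonzero entries of every row to read
  \<open>1, -1, \<dots>, 1, -1, 1, \<dots>, 1\<close>. Hence the horizontal arcs match each \<open>-1\<close> with a \<open>1\<close> of its own,
  and the graph is a forest directed towards its sinks.

  The set of columns met by a conservative subtree is reducing: in every row the matching pairs
  off the \<open>-1\<close>s inside and outside of it, after an exchange of partners between the sink and
  the exceptional source in case (C.2).

  Conversely, if the graph is disconnected, any component will do. If it is connected, only the
  leftmost column has no \<open>-1\<close>. Let \<open>S\<close> be a reducing set without that column, and let \<open>(i, j)\<close>
  be the \<open>-1\<close> in the leftmost column of \<open>S\<close>; the row sum gives a \<open>1\<close> at some \<open>(i, j')\<close> with
  \<open>j < j'\<close>. Because the column sums of \<open>A\<close> decrease, there is then a directed path from \<open>(i, j')\<close> to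
  \<open>(i, j)\<close>, and the vertices that reach \<open>(i, j)\<close> without passing through an arc into \<open>(i, j')\<close> form
  a subtree of type (C.2).
\<close>

section \<open>Row lengths under Ryser's rule\<close>

text \<open>For antitone \<open>c\<close> the set counted by \<open>conjugate c l\<close> is an
  initial segment, so its size is its least non-member.\<close>

lemma less_conjugate_iff:
  assumes "antimono c" and "\<And>i. r \<le> i \<Longrightarrow> c i = 0"
  shows "i < conjugate c l \<longleftrightarrow> l < c i"
proof -
  have dc: "l < c y" if "l < c x" "y \<le> x" for x y
    using antimonoD[OF assms(1) that(2)] that(1) by simp
  have fin: "finite {i. l < c i}"
    by (rule finite_subset[of _ "{..<r}"]) (use assms(2) in \<open>auto simp: not_le[symmetric]\<close>)
  show ?thesis
  proof
    assume "i < conjugate c l"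
    show "l < c i"
    proof (rule ccontr)
      assume "\<not> l < c i"
      then have "{i. l < c i} \<subseteq> {..<i}" using dc by (auto simp: not_le[symmetric])
      then have "card {i. l < c i} \<le> i" using card_mono[of "{..<i}"] by simp
      with \<open>i < conjugate c l\<close> show False by (simp add: conjugate_def)
    qed
  next
    assume "l < c i"
    then have "{..i} \<subseteq> {i. l < c i}" using dc by auto
    from card_mono[OF fin this] show "i < conjugate c l" by (simp add: conjugate_def)
  qed
qed

lemma conjugate_antimono:
  assumes "is_partition r lam" and "j \<le> j'"
  shows "conjugate lam j' \<le> conjugate lam j"
proof (rule ccontr)
  assume "\<not> ?thesis"
  then have "conjugate lam j < conjugate lam j'" by simp
  moreover have "\<And>i l. i < conjugate lam l \<longleftrightarrow> l < lam i"
    using less_conjugate_iff assms(1) by (auto simp: is_partition_def)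
  ultimately show False using \<open>j \<le> j'\<close> by (metis leD le_less_trans less_irrefl)
qed

text \<open>Invariant of the algorithm before the columns \<open>j - 1, ..., 0\<close> are treated:
  \<open>c\<close> lists the remaining row lengths, and \<open>min (lam i) j\<close> is
  \<open>lam\<close> cut to its first \<open>j\<close> columns.\<close>

definition dominated :: "nat \<Rightarrow> (nat \<Rightarrow> nat) \<Rightarrow> nat \<Rightarrow> (nat \<Rightarrow> nat) \<Rightarrow> bool" where
  "dominated r lam j c \<longleftrightarrow> is_partition r c
     \<and> (\<Sum>i<r. c i) = (\<Sum>i<r. min (lam i) j)
     \<and> (\<forall>t. (\<Sum>i<t. c i) \<le> (\<Sum>i<t. min (lam i) j))"

text \<open>
  The row lengths \<open>c\<close>, \<open>c'\<close> before and after a column of size \<open>k\<close> has been split off: rows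
  \<open>a, \<dots>, e\<close> are those tied with row \<open>k - 1\<close>, and of these the \<open>k - a\<close> southernmost are chosen.
\<close>

definition strip_cut :: "nat \<Rightarrow> nat \<Rightarrow> (nat \<Rightarrow> nat) \<Rightarrow> (nat \<Rightarrow> nat) \<Rightarrow> nat \<Rightarrow> nat \<Rightarrow> bool" where
  "strip_cut r k c c' a e \<longleftrightarrow> a < k \<and> k \<le> Suc e \<and> e < r
     \<and> (\<forall>i. c (k - 1) < c i \<longleftrightarrow> i < a) \<and> (\<forall>i. c (k - 1) \<le> c i \<longleftrightarrow> i \<le> e)
     \<and> (\<forall>i. c i = c' i + of_bool (i < a \<or> a + e < i + k \<and> i \<le> e))"

lemma strip_cutD:
  assumes "strip_cut r k c c' a e"
  shows "a < k" "k \<le> Suc e" "e < r" "c (k - 1) < c i \<longleftrightarrow> i < a" "c (k - 1) \<le> c i \<longleftrightarrow> i \<le> e"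
    "c i = c' i + of_bool (i < a \<or> a + e < i + k \<and> i \<le> e)"
  using assms unfolding strip_cut_def by blast+

section \<open>Dominance under the greedy removal of a column\<close>

lemma dominated_le:
  assumes "dominated r lam j c"
  shows "c i \<le> j"
proof -
  have "(\<Sum>i<1. c i) \<le> (\<Sum>i<1. min (lam i) j)"
    using assms unfolding dominated_def by blast
  then have "c 0 \<le> j" by simp
  moreover have "c i \<le> c 0"
    using assms by (auto simp: dominated_def is_partition_def antimono_def)
  ultimately show ?thesis by simp
qed

text \<open>With row \<open>k - 1\<close> empty, the first \<open>k - 1\<close> rows would carry all
  of \<open>c\<close>, yet in the cut-off \<open>lam\<close> row \<open>k - 1\<close> still adds
  weight. Hence every chosen row has a \<open>1\<close> to move.\<close>

lemma dominated_pos: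
  assumes lam: "is_partition r lam" and dom: "dominated r lam (Suc j) c"
    and k: "0 < k" "k \<le> conjugate lam j"
  shows "0 < c (k - 1)"
proof (rule ccontr)
  assume "\<not> 0 < c (k - 1)"
  have c: "antimono c" "\<And>i. r \<le> i \<Longrightarrow> c i = 0"
    using dom by (auto simp: dominated_def is_partition_def)
  have "k - 1 < conjugate lam j" using k by simp
  then have "j < lam (k - 1)"
    using less_conjugate_iff[of lam r "k - 1" j] lam by (simp add: is_partition_def)
  then have kr: "k - 1 < r" using lam by (force simp: is_partition_def not_le[symmetric])
  have z: "c i = 0" if "k - 1 \<le> i" for i
    using antimonoD[OF c(1) that] \<open>\<not> 0 < c (k - 1)\<close> by simp
  have "(\<Sum>i<r. min (lam i) (Suc j)) = (\<Sum>i<r. c i)"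
    using dom by (simp add: dominated_def)
  also have "\<dots> = (\<Sum>i<k - 1. c i)"
    by (rule sum.mono_neutral_right) (use kr z in auto)
  also have "\<dots> \<le> (\<Sum>i<k - 1. min (lam i) (Suc j))"
    using dom unfolding dominated_def by blast
  also have "\<dots> < (\<Sum>i<Suc (k - 1). min (lam i) (Suc j))"
    using \<open>j < lam (k - 1)\<close> by simp
  also have "\<dots> \<le> (\<Sum>i<r. min (lam i) (Suc j))"
    by (rule sum_mono2) (use kr in auto)
  finally show False by simp
qed

lemma strip_cut_exists:
  assumes c: "is_partition r c" and k: "0 < k" "0 < c (k - 1)"
  obtains a e c' where "strip_cut r k c c' a e"
    and "{i. i < r \<and> card {i'. i' < r \<and> (c i < c i' \<or> c i' = c i \<and> i < i')} < k}
      = {i. i < a \<or> a + e < i + k \<and> i \<le> e}"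
proof -
  let ?l = "c (k - 1)"
  \<comment> \<open>\<open>?l\<close> is positive, so \<open>conjugate c (?l - 1)\<close> counts the
    rows at least as long as row \<open>k - 1\<close>; subtracting 1 gives the index of the last
    such row.\<close>
  define a e where "a = conjugate c ?l" and "e = conjugate c (?l - 1) - 1"
  have "\<And>i l. i < conjugate c l \<longleftrightarrow> l < c i"
    using less_conjugate_iff c by (auto simp: is_partition_def)
  then have a: "?l < c i \<longleftrightarrow> i < a" and e0: "i < conjugate c (?l - 1) \<longleftrightarrow> ?l \<le> c i" for i
    using k by (auto simp: a_def)
  have "k - 1 < conjugate c (?l - 1)" using e0[of "k - 1"] by blast
  then have "i < conjugate c (?l - 1) \<longleftrightarrow> i \<le> e" for i by (auto simp: e_def)
  then have e: "?l \<le> c i \<longleftrightarrow> i \<le> e" for i using e0 by simp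
  have ak: "a < k" using a[of "k - 1"] k by simp
  have ke: "k \<le> Suc e" using e[of "k - 1"] k by simp
  have "0 < c e" using e[of e] k by simp
  then have er: "e < r" using c by (cases "e < r") (simp_all add: is_partition_def)
  let ?S = "{i. i < a \<or> a + e < i + k \<and> i \<le> e}"
  define c' where "c' i = c i - of_bool (i \<in> ?S)" for i
  have pos: "0 < c i" if "i \<in> ?S" for i using that a[of i] e[of i] k by auto
  have "c i = c' i + of_bool (i \<in> ?S)" for i
    using pos[of i] by (cases "i \<in> ?S") (simp_all only: c'_def of_bool_eq, simp_all)
  then have "strip_cut r k c c' a e"
    unfolding strip_cut_def using ak ke er a e by simp
  moreover have "{i. i < r \<and> card {i'. i' < r \<and> (c i < c i' \<or> c i' = c i \<and> i < i')} < k} = ?S"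
  proof (rule set_eqI)
    fix i
    let ?T = "{i'. i' < r \<and> (c i < c i' \<or> c i' = c i \<and> i < i')}"
    have fin: "finite ?T" by simp
    consider "i < a" | "a \<le> i" "i \<le> e" | "e < i" by linarith
    then show "i \<in> {i. i < r \<and> card {i'. i' < r \<and> (c i < c i' \<or> c i' = c i \<and> i < i')} < k}
      \<longleftrightarrow> i \<in> ?S"
    proof cases
      case 1
      have "i' < a \<and> i' \<noteq> i" if "i' \<in> ?T" for i'
        using that 1 a[of i] a[of i'] by auto
      then have "?T \<subseteq> {..<a} - {i}" by auto
      then have "card ?T \<le> card ({..<a} - {i})" by (intro card_mono) auto
      then show ?thesis using 1 ak ke er by auto
    next
      case 2
      then have ci: "c i = ?l" using a[of i] e[of i] by simp
      \<comment> \<open>A tied row is preceded by the \<open>a\<close> longer rows and by the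
        \<open>e - i\<close> tied rows south of it.\<close>
      have "i' \<in> ?T \<longleftrightarrow> i' \<in> {..<a} \<union> {i<..e}" for i'
        using ci a[of i'] e[of i'] 2 er by auto
      then have "?T = {..<a} \<union> {i<..e}" by blast
      moreover have "card ({..<a} \<union> {i<..e}) = a + (e - i)"
        using 2 by (subst card_Un_disjoint) auto
      ultimately have "card ?T = a + (e - i)" by (simp only:)
      then have "card ?T < k \<longleftrightarrow> a + e < i + k" using 2 by linarith
      moreover have "i < r" "\<not> i < a" using 2 er by simp_all
      ultimately show ?thesis using \<open>i \<le> e\<close> unfolding mem_Collect_eq by blast
    next
      case 3
      then have "c i < ?l" using e[of i] by simp
      have "i' \<in> ?T" if "i' \<le> e" for i'
        using that e[of i'] er \<open>c i < ?l\<close> by simp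
      then have "{..e} \<subseteq> ?T" by blast
      from card_mono[OF fin this] have "\<not> card ?T < k" using ke by simp
      moreover have "\<not> i < a" "\<not> i \<le> e" using 3 ak ke by simp_all
      ultimately show ?thesis unfolding mem_Collect_eq by blast
    qed
  qed
  ultimately show thesis using that by blast
qed

text \<open>Rows of different length stay ordered, and tied rows lose boxes in a southern segment,
  so of two equal neighbours the upper one never shrinks alone.\<close>

lemma strip_cut_partition:
  assumes cut: "strip_cut r k c c' a e" and c: "is_partition r c"
  shows "is_partition r c'"
proof -
  have "c' (Suc i) \<le> c' i" for i
  proof -
    have "c (Suc i) \<le> c i" using c by (auto simp: is_partition_def antimono_def)
    then show ?thesis
      using strip_cutD(4-6)[OF cut, of i] strip_cutD(4-6)[OF cut, of "Suc i"]
      by (cases "i < a"; cases "i \<le> e"; cases "a + e < i + k") (auto simp: of_bool_def split: if_splits)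
  qed
  then have "antimono c'" by (auto simp: antimono_iff_le_Suc)
  moreover have "c' i = 0" if "r \<le> i" for i
  proof -
    have "c i = 0" using c that by (simp add: is_partition_def)
    then show ?thesis using strip_cutD(6)[OF cut, of i] by simp
  qed
  ultimately show ?thesis by (simp add: is_partition_def)
qed

text \<open>
  This is the Gale--Ryser argument. On the tied rows \<open>[a, e]\<close> the difference of the partial sums
  first increases and then decreases, so it is bounded below by its values at \<open>a\<close> and \<open>e + 1\<close>.
\<close>

lemma strip_cut_dominated:
  assumes lam: "is_partition r lam" and dom: "dominated r lam (Suc j) c"
    and cut: "strip_cut r (conjugate lam j) c c' a e"
  shows "dominated r lam j c'"
proof -
  let ?k = "conjugate lam j" and ?S = "{i. i < a \<or> a + e < i + conjugate lam j \<and> i \<le> e}"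
  let ?l = "c (?k - 1)"
  have c: "is_partition r c" using dom by (simp add: dominated_def)
  have ak: "a < ?k" and ke: "?k \<le> Suc e" and er: "e < r"
    and a: "\<And>i. ?l < c i \<longleftrightarrow> i < a" and e: "\<And>i. ?l \<le> c i \<longleftrightarrow> i \<le> e"
    and c': "\<And>i. c i = c' i + of_bool (i \<in> ?S)"
    using strip_cutD[OF cut] by auto
  have lk: "j < lam i \<longleftrightarrow> i < ?k" for i
    using less_conjugate_iff[of lam r] lam by (auto simp: is_partition_def)
  \<comment> \<open>\<open>g\<close> and \<open>f\<close> measure the excess of the cut-off
    \<open>lam\<close> before and after the step. Their difference weighs the rows in
    \<open>?S\<close> against the rows \<open>i < ?k\<close>, which are those of \<open>lam\<close>
    that lose a box.\<close>
  define f where "f t = (\<Sum>i<t. int (min (lam i) j) - int (c' i))" for t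
  define g where "g t = (\<Sum>i<t. int (min (lam i) (Suc j)) - int (c i))" for t
  have g0: "0 \<le> g t" for t
  proof -
    have "(\<Sum>i<t. c i) \<le> (\<Sum>i<t. min (lam i) (Suc j))"
      using dom unfolding dominated_def by blast
    then have "int (\<Sum>i<t. c i) \<le> int (\<Sum>i<t. min (lam i) (Suc j))" by (rule zle_int[THEN iffD2])
    then show ?thesis by (simp add: g_def sum_subtractf)
  qed
  have gr: "g r = 0"
  proof -
    have "int (\<Sum>i<r. c i) = int (\<Sum>i<r. min (lam i) (Suc j))"
      using dom by (simp add: dominated_def)
    then show ?thesis by (simp add: g_def sum_subtractf)
  qed
  have fg: "f t = g t + ((\<Sum>i<t. of_bool (i \<in> ?S)) - (\<Sum>i<t. of_bool (i < ?k)))" for t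
  proof -
    have "int (min (lam i) j) - int (c' i)
      = (int (min (lam i) (Suc j)) - int (c i)) + (of_bool (i \<in> ?S) - of_bool (i < ?k))" for i
      using c'[of i] lk[of i] by (auto simp: min_def of_bool_def split: if_splits)
    then show ?thesis by (simp add: f_def g_def sum.distrib sum_subtractf)
  qed
  have f_low: "f t = g t" if "t \<le> a" for t
  proof -
    have "(\<Sum>i<t. of_bool (i \<in> ?S)) = (\<Sum>i<t. of_bool (i < ?k) :: int)"
      by (rule sum.cong) (use that ak in auto)
    then show ?thesis using fg[of t] by simp
  qed
  have f_high: "f t = g t" if "e < t" for t
  proof -
    have "?S = {..<a} \<union> {Suc (a + e) - ?k..e}" using ak ke by auto
    then have "(\<Sum>i\<in>?S. 1 :: int) = (\<Sum>i\<in>{..<a} \<union> {Suc (a + e) - ?k..e}. 1)" by simp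
    also have "\<dots> = int (a + (?k - a))"
      using ak ke by (subst sum.union_disjoint) auto
    also have "\<dots> = int ?k" using ak by simp
    also have "\<dots> = (\<Sum>i<?k. 1 :: int)" by simp
    also have "\<dots> = (\<Sum>i<t. of_bool (i < ?k))"
      by (rule sum.mono_neutral_cong_left) (use that ke in auto)
    finally have "(\<Sum>i\<in>?S. 1 :: int) = (\<Sum>i<t. of_bool (i < ?k))" .
    moreover have "(\<Sum>i<t. of_bool (i \<in> ?S)) = (\<Sum>i\<in>?S. 1 :: int)"
      by (rule sum.mono_neutral_cong_right) (use that ak ke in auto)
    ultimately show ?thesis using fg[of t] by (simp only: diff_self add_0_right)
  qed
  have antil: "lam y \<le> lam x" if "x \<le> y" for x y
    using lam that by (auto simp: is_partition_def antimono_def)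
  have f0: "0 \<le> f t" for t
  proof -
    consider "t \<le> a" | "e < t" | "a < t" "t \<le> e" by linarith
    then show ?thesis
    proof cases
      case 3
      show ?thesis
      proof (cases "?l \<le> min (lam (t - 1)) j")
        case True
        have "f t = f a + (\<Sum>i\<in>{a..<t}. int (min (lam i) j) - int (c' i))"
          using 3 by (simp add: f_def lessThan_atLeast0 sum.atLeastLessThan_concat)
        moreover have "0 \<le> int (min (lam i) j) - int (c' i)" if "i \<in> {a..<t}" for i
        proof -
          have "c i = ?l" using that 3 a[of i] e[of i] by auto
          moreover have "lam (t - 1) \<le> lam i" using that antil by auto
          ultimately show ?thesis using True c'[of i] by auto
        qed
        then have "0 \<le> (\<Sum>i\<in>{a..<t}. int (min (lam i) j) - int (c' i))" by (rule sum_nonneg)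
        ultimately show ?thesis using f_low[of a] g0[of a] by simp
      next
        case False
        have "f (Suc e) = f t + (\<Sum>i\<in>{t..<Suc e}. int (min (lam i) j) - int (c' i))"
          using 3 unfolding f_def lessThan_atLeast0 by (subst sum.atLeastLessThan_concat) auto
        moreover have "int (min (lam i) j) - int (c' i) \<le> 0" if "i \<in> {t..<Suc e}" for i
        proof -
          have "c i = ?l" using that 3 a[of i] e[of i] by auto
          moreover have "lam i \<le> lam (t - 1)" using that antil by auto
          moreover have "c i \<le> c' i + 1" using c'[of i] by (auto simp: of_bool_def)
          ultimately show ?thesis using False by auto
        qed
        then have "(\<Sum>i\<in>{t..<Suc e}. int (min (lam i) j) - int (c' i)) \<le> 0" by (rule sum_nonpos)
        ultimately show ?thesis using f_high[of "Suc e"] g0[of "Suc e"] by simp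
      qed
    qed (use f_low f_high g0 in auto)
  qed
  have "f r = 0" using f_high[OF er] gr by simp
  then have "int (\<Sum>i<r. c' i) = int (\<Sum>i<r. min (lam i) j)"
    by (simp add: f_def sum_subtractf)
  then have "(\<Sum>i<r. c' i) = (\<Sum>i<r. min (lam i) j)" by (rule of_nat_eq_iff[THEN iffD1])
  moreover have "(\<Sum>i<t. c' i) \<le> (\<Sum>i<t. min (lam i) j)" for t
  proof -
    have "int (\<Sum>i<t. c' i) \<le> int (\<Sum>i<t. min (lam i) j)"
      using f0[of t] by (simp add: f_def sum_subtractf)
    then show ?thesis by (rule zle_int[THEN iffD1])
  qed
  ultimately show ?thesis
    using strip_cut_partition[OF cut c] by (simp add: dominated_def)
qed

section \<open>The canonical matrix as a chain of row lengths\<close>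

lemma ryser_step_cut:
  assumes lam: "is_partition r lam" and j: "j < lam 0"
    and dom: "dominated r lam (Suc j) c"
    and M: "\<And>i p. p \<le> j \<Longrightarrow> M i p = of_bool (p < c i)"
  obtains c' a e where "strip_cut r (conjugate lam j) c c' a e" "dominated r lam j c'"
    "\<And>i p. p < j \<Longrightarrow> ryser_step r lam j M i p = of_bool (p < c' i)"
    "\<And>i. ryser_step r lam j M i j = int (c i) - int (c' i)"
    "\<And>i p. j < p \<Longrightarrow> ryser_step r lam j M i p = M i p"
proof -
  let ?k = "conjugate lam j"
  have c: "is_partition r c" using dom by (simp add: dominated_def)
  have k: "0 < ?k"
    using less_conjugate_iff[of lam r 0 j] lam j by (simp add: is_partition_def)
  obtain a e c' where cut: "strip_cut r ?k c c' a e"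
    and S: "{i. i < r \<and> card {i'. i' < r \<and> (c i < c i' \<or> c i' = c i \<and> i < i')} < ?k}
      = {i. i < a \<or> a + e < i + ?k \<and> i \<le> e}"
    by (rule strip_cut_exists[OF c k dominated_pos[OF lam dom k order.refl]])
  have dom': "dominated r lam j c'" by (rule strip_cut_dominated[OF lam dom cut])
  have "row_ones M j i = {..<c i}" for i
    using dominated_le[OF dom, of i] M by (auto simp: row_ones_def)
  then have ones: "row_ones M j = (\<lambda>i. {..<c i})" by blast
  have "row_before M j i' i \<longleftrightarrow> c i < c i' \<or> c i' = c i \<and> i < i'" for i i'
    by (simp add: row_before_def ones)
  then have ch: "chosen_rows r M j ?k = {i. i < a \<or> a + e < i + ?k \<and> i \<le> e}"
    using S by (simp add: chosen_rows_def)
  have c': "c i = c' i + of_bool (i \<in> chosen_rows r M j ?k)" for i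
    unfolding ch using strip_cutD(6)[OF cut] by simp
  have max: "Max (row_ones M j i) = c i - 1" if "i \<in> chosen_rows r M j ?k" for i
  proof -
    have "0 < c i" using c'[of i] that by simp
    then show ?thesis unfolding ones by (intro Max_eqI) auto
  qed
  have le: "c' i \<le> j" for i by (rule dominated_le[OF dom'])
  show thesis
  proof (rule that[OF cut dom'])
    fix i p :: nat assume "p < j"
    then show "ryser_step r lam j M i p = of_bool (p < c' i)"
      using c'[of i] max[of i] M[of p i] by (auto simp: ryser_step_def)
  next
    fix i
    \<comment> \<open>An unchosen row has \<open>c i = c' i \<le> j\<close>, hence a
      \<open>0\<close> in column \<open>j\<close>. A row of length \<open>Suc j\<close> must be
      chosen; its last \<open>1\<close> already stands in column \<open>j\<close>, where the second
      update overrides the first.\<close>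
    show "ryser_step r lam j M i j = int (c i) - int (c' i)"
      using c'[of i] M[of j i] le[of i] by (auto simp: ryser_step_def)
  next
    fix i p :: nat assume "j < p"
    moreover have "c i - 1 \<le> j" using dominated_le[OF dom, of i] by simp
    ultimately show "ryser_step r lam j M i p = M i p"
      using max[of i] by (auto simp: ryser_step_def)
  qed
qed

text \<open>\<open>C t\<close> holds the row lengths once only the columns below \<open>t\<close>
  are untreated; column \<open>t\<close> of the result records the boxes removed in passing from
  \<open>C (Suc t)\<close> to \<open>C t\<close>.\<close>

lemma ryser_iter_chain:
  assumes lam: "is_partition r lam" and j: "j \<le> lam 0" and dom: "dominated r lam j c"
    and M: "\<And>i p. p < j \<Longrightarrow> M i p = of_bool (p < c i)"
  shows "\<exists>C. C j = c \<and> (\<forall>t\<le>j. dominated r lam t (C t))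
    \<and> (\<forall>t<j. \<exists>a e. strip_cut r (conjugate lam t) (C (Suc t)) (C t) a e)
    \<and> (\<forall>i. \<forall>t<j. ryser_iter r lam j M i t = int (C (Suc t) i) - int (C t i))
    \<and> (\<forall>i. \<forall>p\<ge>j. ryser_iter r lam j M i p = M i p)"
  using assms
proof (induction j arbitrary: M c)
  case 0
  then show ?case by (intro exI[of _ "\<lambda>_. c"]) simp
next
  case (Suc j)
  let ?M = "ryser_step r lam j M"
  obtain c' a e where cut: "strip_cut r (conjugate lam j) c c' a e"
    and dom': "dominated r lam j c'"
    and M': "\<And>i p. p < j \<Longrightarrow> ?M i p = of_bool (p < c' i)"
      "\<And>i. ?M i j = int (c i) - int (c' i)" "\<And>i p. j < p \<Longrightarrow> ?M i p = M i p"
    using ryser_step_cut[of r lam j c M] Suc.prems by (metis Suc_le_eq less_Suc_eq_le)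
  obtain C where C: "C j = c'" "\<forall>t\<le>j. dominated r lam t (C t)"
    "\<forall>t<j. \<exists>a e. strip_cut r (conjugate lam t) (C (Suc t)) (C t) a e"
    "\<forall>i. \<forall>t<j. ryser_iter r lam j ?M i t = int (C (Suc t) i) - int (C t i)"
    "\<forall>i. \<forall>p\<ge>j. ryser_iter r lam j ?M i p = ?M i p"
    using Suc.IH[OF lam _ dom', of ?M] Suc.prems(2) M'(1) by auto
  show ?case
    by (rule exI[of _ "C(Suc j := c)"])
      (use C cut M' Suc.prems(3) in \<open>auto simp: less_Suc_eq le_Suc_eq\<close>)
qed

lemma canonical_matrix_chain:
  assumes "(lam, mu) \<in> Kostka r"
  obtains C where "\<And>t. t \<le> lam 0 \<Longrightarrow> dominated r lam t (C t)"
    "\<And>t. t < lam 0 \<Longrightarrow> \<exists>a e. strip_cut r (conjugate lam t) (C (Suc t)) (C t) a e"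
    "\<And>i t. t < lam 0 \<Longrightarrow> canonical_matrix r lam mu i t = int (C (Suc t) i) - int (C t i)"
proof -
  have lam: "is_partition r lam" and mu: "is_partition r mu"
    and eq: "(\<Sum>i<r. lam i) = (\<Sum>i<r. mu i)" and le: "\<And>t. (\<Sum>i<t. mu i) \<le> (\<Sum>i<t. lam i)"
    using assms by (auto simp: Kostka_def)
  \<comment> \<open>All of \<open>lam\<close> lies in its first \<open>lam 0\<close> columns, so the
    Kostka condition is the initial invariant.\<close>
  have "min (lam i) (lam 0) = lam i" for i
    using lam by (auto simp: is_partition_def antimono_def min_def)
  then have dom: "dominated r lam (lam 0) mu"
    using mu eq le by (simp add: dominated_def)
  have "(if i < r \<and> p < mu i then 1 else 0) = (of_bool (p < mu i) :: int)" for i p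
    using mu by (auto simp: is_partition_def not_less)
  then show thesis
    using that ryser_iter_chain[OF lam order.refl dom,
        of "\<lambda>i j. if i < r \<and> j < mu i then 1 else 0"]
    unfolding canonical_matrix_def by blast
qed

section \<open>Connected components of digraphs\<close>

lemma (in wf_digraph) rtrancl_symcl_in_verts:
  assumes "(u, v) \<in> (symcl (arcs_ends G))\<^sup>*" and "u \<in> verts G"
  shows "v \<in> verts G"
  using assms by induction (auto simp: symcl_def adj_in_verts)

lemma (in wf_digraph) connected_iff_rtrancl_symcl:
  "connected G \<longleftrightarrow> verts G \<noteq> {} \<and> (\<forall>u\<in>verts G. \<forall>v\<in>verts G. (u, v) \<in> (symcl (arcs_ends G))\<^sup>*)"
proof -
  have "(u, v) \<in> rtrancl_on (verts G) (symcl (arcs_ends G)) \<longleftrightarrow> (u, v) \<in> (symcl (arcs_ends G))\<^sup>*"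
    if "u \<in> verts G" for u v
  proof
    assume "(u, v) \<in> (symcl (arcs_ends G))\<^sup>*"
    then show "(u, v) \<in> rtrancl_on (verts G) (symcl (arcs_ends G))"
      by (rule rtrancl_consistent_rtrancl_on)
        (use that rtrancl_symcl_in_verts[OF \<open>(u, v) \<in> _\<close>] in \<open>auto simp: symcl_def adj_in_verts\<close>)
  qed (rule rtrancl_on_rtranclI)
  then show ?thesis unfolding connected_conv by blast
qed

lemma sym_rtrancl_symcl: "sym ((symcl R)\<^sup>*)"
  by (rule sym_rtrancl) (auto simp: symcl_def intro: symI)

lemma (in wf_digraph) connectedI_hub:
  assumes "c \<in> verts G" and "\<And>u. u \<in> verts G \<Longrightarrow> (u, c) \<in> (symcl (arcs_ends G))\<^sup>*"
  shows "connected G"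
  unfolding connected_iff_rtrancl_symcl
proof (intro conjI ballI)
  show "verts G \<noteq> {}" using assms(1) by blast
  fix u v assume "u \<in> verts G" "v \<in> verts G"
  from assms(2)[OF this(1)] symD[OF sym_rtrancl_symcl assms(2)[OF this(2)]]
  show "(u, v) \<in> (symcl (arcs_ends G))\<^sup>*" by (rule rtrancl_trans)
qed

text \<open>Adjoining \<open>e\<close> and its end points to \<open>H\<close> keeps it connected,
  through the end that is already in \<open>H\<close>; maximality then forces the enlargement
  \<open>H'\<close> to equal \<open>H\<close>.\<close>

lemma max_connected_subgraph_closed:
  assumes max: "pre_digraph.max_subgraph G connected H"
    and e: "e \<in> arcs G" "tail G e \<in> verts H \<or> head G e \<in> verts H"
  shows "e \<in> arcs H" "tail G e \<in> verts H" "head G e \<in> verts H"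
proof -
  have sub: "subgraph H G" and conn: "connected H"
    using max unfolding pre_digraph.max_subgraph_def by auto
  interpret G: wf_digraph G using sub by (simp add: subgraph_def)
  interpret H: wf_digraph H using sub by (simp add: subgraph_def)
  have th: "tail H = tail G" "head H = head G"
    using sub by (auto simp: subgraph_def compatible_def)
  define H' where "H' = \<lparr> verts = verts H \<union> {tail G e, head G e}, arcs = insert e (arcs H),
    tail = tail G, head = head G \<rparr>"
  interpret H': wf_digraph H'
    by unfold_locales (use th H.tail_in_verts H.head_in_verts in \<open>auto simp: H'_def\<close>)
  have HH': "subgraph H H'" "subgraph H' G"
    using sub e(1) H'.wf_digraph H.wf_digraph G.wf_digraph th
    by (auto simp: subgraph_def compatible_def H'_def)
  have ends: "arcs_ends H \<subseteq> arcs_ends H'" "(tail G e, head G e) \<in> arcs_ends H'"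
    by (auto simp: arcs_ends_conv H'_def th)
  then have mono: "(symcl (arcs_ends H))\<^sup>* \<subseteq> (symcl (arcs_ends H'))\<^sup>*"
    by (intro rtrancl_mono) (auto simp: symcl_def)
  obtain c where c: "c \<in> verts H" "c = tail G e \<or> c = head G e" using e(2) by blast
  have "connected H'"
  proof (rule H'.connectedI_hub)
    show "c \<in> verts H'" using c by (simp add: H'_def)
    fix u assume "u \<in> verts H'"
    then consider "u \<in> verts H" | "u \<in> {tail G e, head G e}" by (auto simp: H'_def)
    then show "(u, c) \<in> (symcl (arcs_ends H'))\<^sup>*"
    proof cases
      case 1
      then show ?thesis using conn c mono unfolding H.connected_iff_rtrancl_symcl by blast
    next
      case 2
      then show ?thesis using c ends(2) by (auto simp: symcl_def)
    qed
  qed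
  with max HH' have "H' = H" unfolding pre_digraph.max_subgraph_def by blast
  moreover have "e \<in> arcs H'" "tail G e \<in> verts H'" "head G e \<in> verts H'"
    by (auto simp: H'_def)
  ultimately show "e \<in> arcs H" "tail G e \<in> verts H" "head G e \<in> verts H" by simp_all
qed

lemma (in wf_digraph) max_connected_subgraph_exists:
  assumes x: "x \<in> verts G"
  obtains H where "max_subgraph connected H" "x \<in> verts H"
proof -
  define V where "V = {y. (x, y) \<in> (symcl (arcs_ends G))\<^sup>*}"
  have V: "V \<subseteq> verts G" using rtrancl_symcl_in_verts x by (auto simp: V_def)
  have xV: "x \<in> V" by (simp add: V_def)
  have sub: "subgraph (G \<restriction> V) G" using V by (rule subgraph_induce_subgraphI)
  interpret I: wf_digraph "G \<restriction> V" using sub by (simp add: subgraph_def)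
  have reach: "(x, y) \<in> (symcl (arcs_ends (G \<restriction> V)))\<^sup>*" if "(x, y) \<in> (symcl (arcs_ends G))\<^sup>*" for y
    using that
  proof induction
    case (step y z)
    have "y \<in> V" "z \<in> V" using step.hyps by (auto simp: V_def)
    then have "(y, z) \<in> symcl (arcs_ends (G \<restriction> V))"
      using step.hyps(2) by (auto simp: symcl_def arcs_ends_conv)
    then show ?case using step.IH by simp
  qed simp
  have "connected (G \<restriction> V)"
  proof (rule I.connectedI_hub)
    show "x \<in> verts (G \<restriction> V)" using xV by simp
    fix u assume "u \<in> verts (G \<restriction> V)"
    then have "(x, u) \<in> (symcl (arcs_ends (G \<restriction> V)))\<^sup>*" using reach by (simp add: V_def)
    then show "(u, x) \<in> (symcl (arcs_ends (G \<restriction> V)))\<^sup>*" using sym_rtrancl_symcl by (rule symD[rotated])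
  qed
  moreover have "\<not> connected H'" if ne: "G \<restriction> V \<noteq> H'" and 1: "subgraph (G \<restriction> V) H'" and 2: "subgraph H' G" for H'
  proof
    assume conn: "connected H'"
    interpret H': wf_digraph H' using 2 by (simp add: subgraph_def)
    have th: "tail H' = tail G" "head H' = head G" using 2 by (auto simp: subgraph_def compatible_def)
    have "arcs_ends H' \<subseteq> arcs_ends G" using 2 th by (auto simp: subgraph_def arcs_ends_conv)
    then have mono: "(symcl (arcs_ends H'))\<^sup>* \<subseteq> (symcl (arcs_ends G))\<^sup>*"
      by (intro rtrancl_mono) (auto simp: symcl_def)
    have "x \<in> verts H'" using 1 xV by (auto simp: subgraph_def)
    then have "(x, y) \<in> (symcl (arcs_ends G))\<^sup>*" if "y \<in> verts H'" for y
      using that conn mono unfolding H'.connected_iff_rtrancl_symcl by blast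
    then have v: "verts H' = V" using 1 by (auto simp: V_def subgraph_def)
    moreover have "arcs H' = arcs (G \<restriction> V)"
      using 1 2 v th H'.tail_in_verts H'.head_in_verts by (auto simp: subgraph_def)
    ultimately have "G \<restriction> V = H'" by (intro pre_digraph.equality) (simp_all add: th)
    with ne show False by contradiction
  qed
  ultimately have "max_subgraph connected (G \<restriction> V)" using sub by (intro max_subgraphI) auto
  with that xV show thesis by simp
qed

section \<open>The KGR graph\<close>

locale kostka_pair =
  fixes r :: nat and lam mu :: "nat \<Rightarrow> nat"
  assumes kostka: "(lam, mu) \<in> Kostka r"
begin

abbreviation "B \<equiv> star_matrix r lam mu"
abbreviation "K \<equiv> conjugate lam"
abbreviation "G \<equiv> kgr_graph r lam mu"

text \<open>With \<open>C t\<close> the row lengths at stage \<open>t\<close>, this telescopes to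
  \<open>C t i - C t (Suc i)\<close>, the number of columns of length \<open>Suc i\<close> in that
  shape. This is why it is never negative.\<close>

definition prefix :: "nat \<Rightarrow> nat \<Rightarrow> int" where
  "prefix t i = (\<Sum>l<t. B i l)"

text \<open>
  Column \<open>t\<close> of the canonical matrix consists of a block of ones in the rows above \<open>a\<close> and one
  ending in row \<open>e\<close>; the two blocks coincide when \<open>K t = e + 1\<close>.
\<close>

definition column_shape :: "nat \<Rightarrow> nat \<Rightarrow> nat \<Rightarrow> bool" where
  "column_shape t a e \<longleftrightarrow> a < K t \<and> K t \<le> Suc e \<and> e < r \<and> 0 < prefix (Suc t) e
     \<and> (\<forall>x. a \<le> x \<and> x < e \<longrightarrow> prefix (Suc t) x = 0)
     \<and> (0 < a \<longrightarrow> 0 < prefix (Suc t) (a - 1))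
     \<and> (\<forall>i. B i t = (if i = e \<or> K t \<le> e \<and> Suc i = a then 1
          else if K t \<le> e \<and> i + K t = a + e then -1 else 0))"

lemma K_antimono: "t \<le> t' \<Longrightarrow> K t' \<le> K t"
  using conjugate_antimono kostka by (auto simp: Kostka_def)

lemma prefix_0 [simp]: "prefix 0 i = 0"
  by (simp add: prefix_def)

lemma prefix_Suc: "prefix (Suc t) i = prefix t i + B i t"
  by (simp add: prefix_def)

text \<open>Column \<open>t\<close> of the canonical matrix is the indicator of the chosen rows, and
  \<open>B\<close> is its difference with the row below: a \<open>1\<close> at the end of each
  nonempty block and a \<open>-1\<close> just above the second one. For \<open>K t = Suc e\<close>
  the blocks fuse and the \<open>-1\<close> disappears.\<close>

lemma canonical_nonneg: "t < lam 0 \<Longrightarrow> 0 \<le> canonical_matrix r lam mu i t"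
  and prefix_nonneg: "t \<le> lam 0 \<Longrightarrow> 0 \<le> prefix t i"
  and column_shape_exists: "t < lam 0 \<Longrightarrow> \<exists>a e. column_shape t a e"
proof -
  obtain C where dom: "\<And>t. t \<le> lam 0 \<Longrightarrow> dominated r lam t (C t)"
    and cut: "\<And>t. t < lam 0 \<Longrightarrow> \<exists>a e. strip_cut r (K t) (C (Suc t)) (C t) a e"
    and A: "\<And>i t. t < lam 0 \<Longrightarrow> canonical_matrix r lam mu i t = int (C (Suc t) i) - int (C t i)"
    using canonical_matrix_chain[OF kostka] by metis
  define gap where "gap t i = int (C t i) - int (C t (Suc i))" for t i
  have C0: "C t i = 0" if "t \<le> lam 0" "r \<le> i" for t i
    using dom[OF that(1)] that(2) by (simp add: dominated_def is_partition_def)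
  have B: "B i t = gap (Suc t) i - gap t i" if "t < lam 0" for t i
    using that C0[of "Suc t" "Suc i"] C0[of t "Suc i"] by (auto simp: star_matrix_def A gap_def)
  have P: "prefix t i = gap t i" if "t \<le> lam 0" for t i
    using that
  proof (induction t)
    case 0
    then show ?case using dominated_le[OF dom[of 0]] by (simp add: gap_def)
  next
    case (Suc t)
    then show ?case by (simp add: prefix_Suc B)
  qed
  have gap0: "0 \<le> gap t i" if "t \<le> lam 0" for t i
    using dom[OF that] by (simp add: gap_def dominated_def is_partition_def antimono_iff_le_Suc)
  show "0 \<le> prefix t i" if "t \<le> lam 0" using P gap0 that by simp
  have chi: "\<exists>a e. strip_cut r (K t) (C (Suc t)) (C t) a e
      \<and> (\<forall>i. int (C (Suc t) i) - int (C t i) = of_bool (i < a \<or> a + e < i + K t \<and> i \<le> e))"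
    if "t < lam 0" for t
    using cut[OF that] strip_cutD(6) by fastforce
  show "0 \<le> canonical_matrix r lam mu i t" if "t < lam 0"
    using chi[OF that] unfolding A[OF that] by (metis of_bool_less_eq_iff of_bool_eq(1))
  show "\<exists>a e. column_shape t a e" if t: "t < lam 0"
  proof -
    obtain a e where cut: "strip_cut r (K t) (C (Suc t)) (C t) a e"
      and chi: "\<And>i. int (C (Suc t) i) - int (C t i) = of_bool (i < a \<or> a + e < i + K t \<and> i \<le> e)"
      using chi[OF t] by blast
    note D = strip_cutD[OF cut]
    have P: "prefix (Suc t) i = gap (Suc t) i" for i using P t by simp
    have "B i t = of_bool (i < a \<or> a + e < i + K t \<and> i \<le> e)
        - of_bool (Suc i < a \<or> a + e < Suc i + K t \<and> Suc i \<le> e)" for i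
      using B[OF t, of i] chi[of i] chi[of "Suc i"] by (simp add: gap_def)
    then have "B i t = (if i = e \<or> K t \<le> e \<and> Suc i = a then 1
          else if K t \<le> e \<and> i + K t = a + e then -1 else 0)" for i
      using D(1,2) by (auto simp: of_bool_def)
    moreover have "0 < prefix (Suc t) e"
      using D(5)[of e] D(5)[of "Suc e"] by (simp add: P gap_def)
    moreover have "prefix (Suc t) x = 0" if "a \<le> x" "x < e" for x
      using D(4,5)[of x] D(4,5)[of "Suc x"] that by (simp add: P gap_def)
    moreover have "0 < prefix (Suc t) (a - 1)" if "0 < a"
      using D(4)[of "a - 1"] D(4)[of a] that by (simp add: P gap_def)
    ultimately have "column_shape t a e"
      unfolding column_shape_def using D(1-3) by blast
    then show ?thesis by blast
  qed
qed

lemma column_shapeD: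
  assumes "column_shape t a e"
  shows "a < K t" "K t \<le> Suc e" "e < r" "0 < prefix (Suc t) e"
    "\<And>x. a \<le> x \<Longrightarrow> x < e \<Longrightarrow> prefix (Suc t) x = 0"
    "0 < a \<Longrightarrow> 0 < prefix (Suc t) (a - 1)"
    "\<And>i. B i t = (if i = e \<or> K t \<le> e \<and> Suc i = a then 1
          else if K t \<le> e \<and> i + K t = a + e then -1 else 0)"
  using assms unfolding column_shape_def by blast+

lemma star_cases:
  assumes "t < lam 0"
  shows "B i t = 1 \<or> B i t = 0 \<or> B i t = -1"
proof -
  obtain a e where ae: "column_shape t a e" using column_shape_exists[OF assms] by blast
  show ?thesis using column_shapeD(7)[OF ae, of i] by (simp split: if_splits)
qed

lemma star_outside:
  assumes "t < lam 0" and "B i t \<noteq> 0"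
  shows "i < r"
proof -
  obtain a e where ae: "column_shape t a e" using column_shape_exists[OF assms(1)] by blast
  show ?thesis using assms(2) column_shapeD(1-3)[OF ae] column_shapeD(7)[OF ae, of i]
    by (auto split: if_splits)
qed

lemma column_neg_unique: "t < lam 0 \<Longrightarrow> B i t = -1 \<Longrightarrow> B i' t = -1 \<Longrightarrow> i = i'"
proof -
  assume t: "t < lam 0" and i: "B i t = -1" "B i' t = -1"
  obtain a e where ae: "column_shape t a e" using column_shape_exists[OF t] by blast
  show "i = i'" using i column_shapeD(7)[OF ae, of i] column_shapeD(7)[OF ae, of i']
    by (auto split: if_splits)
qed

lemma column_pos_exists:
  assumes "t < lam 0"
  shows "\<exists>i<r. B i t = 1"
proof -
  obtain a e where ae: "column_shape t a e" using column_shape_exists[OF assms] by blast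
  show ?thesis using column_shapeD(3)[OF ae] column_shapeD(7)[OF ae, of e] by auto
qed

lemma column_pos_unique:
  assumes t: "t < lam 0" and no: "\<And>i. B i t \<noteq> -1" and i: "B i t = 1" "B i' t = 1"
  shows "i = i'"
proof -
  obtain a e where ae: "column_shape t a e" using column_shape_exists[OF t] by blast
  note D = column_shapeD[OF ae]
  have "\<not> K t \<le> e"
  proof
    assume "K t \<le> e"
    then have "B (a + e - K t) t = -1" using D(1) D(7)[of "a + e - K t"] by auto
    with no show False by blast
  qed
  with i D(7)[of i] D(7)[of i'] show ?thesis by (auto split: if_splits)
qed

text \<open>A \<open>-1\<close> sits between two rows that are tied at stage \<open>Suc t\<close>
  and of which only the lower one loses a box: their gap is \<open>0\<close> at that stage and
  \<open>1\<close> at stage \<open>t\<close>. So each \<open>-1\<close> brings the partial sum of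
  its row from \<open>1\<close> down to \<open>0\<close>.\<close>

lemma prefix_neg:
  assumes t: "t < lam 0" and neg: "B i t = -1"
  shows "prefix (Suc t) i = 0" "prefix t i = 1"
proof -
  obtain a e where ae: "column_shape t a e" using column_shape_exists[OF t] by blast
  note D = column_shapeD[OF ae]
  have "K t \<le> e" "i + K t = a + e" using neg D(7)[of i] by (auto split: if_splits)
  then have "a \<le> i" "i < e" using D(1) by auto
  then show "prefix (Suc t) i = 0" by (rule D(5))
  then show "prefix t i = 1" using neg by (simp add: prefix_Suc)
qed

lemma first_column_not_neg: "0 < lam 0 \<Longrightarrow> B i 0 \<noteq> -1"
  using prefix_neg(2)[of 0 i] by auto

text \<open>Take the last nonzero entry before column \<open>j\<close>. The partial sum up to and
  including it is \<open>1\<close>, whereas after a \<open>-1\<close> it would be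
  \<open>0\<close>.\<close>

lemma neg_partner_exists:
  assumes j: "j < lam 0" and neg: "B i j = -1"
  shows "\<exists>k<j. B i k = 1 \<and> (\<forall>l. k < l \<and> l < j \<longrightarrow> B i l = 0)"
proof -
  have ex: "\<exists>k<j. B i k \<noteq> 0"
  proof (rule ccontr)
    assume "\<not> ?thesis"
    then have "prefix j i = 0" by (simp add: prefix_def)
    with prefix_neg(2)[OF assms] show False by simp
  qed
  define k where "k = Max {k. k < j \<and> B i k \<noteq> 0}"
  have fin: "finite {k. k < j \<and> B i k \<noteq> 0}" by simp
  have k: "k < j" "B i k \<noteq> 0" using Max_in[OF fin] ex unfolding k_def by auto
  have z: "B i l = 0" if "k < l" "l < j" for l
    using Max_ge[OF fin, of l] that unfolding k_def[symmetric] by auto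
  have "prefix j i = prefix (Suc k) i + (\<Sum>l\<in>{Suc k..<j}. B i l)"
    using k(1) unfolding prefix_def lessThan_atLeast0 by (subst sum.atLeastLessThan_concat) auto
  then have "prefix (Suc k) i = 1" using z prefix_neg(2)[OF assms] by (simp add: Suc_le_eq)
  then have "B i k \<noteq> -1" using prefix_neg(1)[of k i] k j by auto
  then show ?thesis using k z star_cases[of k i] j by auto
qed

definition partner :: "nat \<Rightarrow> nat \<Rightarrow> nat" where
  "partner i j = (SOME k. k < j \<and> B i k = 1 \<and> (\<forall>l. k < l \<and> l < j \<longrightarrow> B i l = 0))"

lemma partner:
  assumes "j < lam 0" "B i j = -1"
  shows "partner i j < j" "B i (partner i j) = 1"
    "\<And>l. partner i j < l \<Longrightarrow> l < j \<Longrightarrow> B i l = 0"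
  using someI_ex[OF neg_partner_exists[OF assms]] unfolding partner_def by blast+

text \<open>Were a partner shared, the left one of the two \<open>-1\<close>s would lie in the
  stretch where the row vanishes.\<close>

lemma partner_inj:
  assumes "j < lam 0" "B i j = -1" "j' < lam 0" "B i j' = -1" "partner i j = partner i j'"
  shows "j = j'"
  using partner(1)[of j i] partner(3)[of j i j'] partner(1)[of j' i] partner(3)[of j' i j] assms
  by (cases j j' rule: linorder_cases) auto

section \<open>Arcs and forest structure of the KGR graph\<close>

lemma horizontal_arcs_eq:
  "horizontal_arcs r lam mu = {((i, j), (i, partner i j)) | i j. j < lam 0 \<and> B i j = -1}"
proof -
  have "k = partner i j"
    if j: "j < lam 0" "B i j = -1" and k: "k < j" "B i k = 1" "\<forall>l. k < l \<and> l < j \<longrightarrow> B i l \<noteq> 1" for i j k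
    using partner[OF j] k by (cases k "partner i j" rule: linorder_cases) auto
  then have "e \<in> {((i, j), (i, partner i j)) | i j. j < lam 0 \<and> B i j = -1}"
    if "e \<in> horizontal_arcs r lam mu" for e
    using that unfolding horizontal_arcs_def by blast
  moreover have "((i, j), (i, partner i j)) \<in> horizontal_arcs r lam mu"
    if j: "j < lam 0" "B i j = -1" for i j
  proof -
    have "i < r" using j by (intro star_outside[of j]) auto
    moreover have "\<forall>l. partner i j < l \<and> l < j \<longrightarrow> B i l \<noteq> 1" using partner(3)[OF j] by simp
    ultimately show ?thesis unfolding horizontal_arcs_def using j partner[OF j] by blast
  qed
  ultimately show ?thesis by blast
qed

lemma vertical_arcs_eq:
  "vertical_arcs r lam mu = {((i, j), (i', j)) | i i' j. j < lam 0 \<and> B i j = 1 \<and> B i' j = -1}"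
proof -
  have "i < r" "i' < r" if "j < lam 0" "B i j = 1" "B i' j = -1" for i i' j
    using that star_outside[of j i] star_outside[of j i'] by auto
  then show ?thesis unfolding vertical_arcs_def by blast
qed

lemma vertical_arcs_same_head:
  assumes a: "a \<in> vertical_arcs r lam mu" and b: "b \<in> vertical_arcs r lam mu"
    and col: "snd (fst b) = snd (fst a)"
  shows "snd b = snd a"
proof -
  obtain x x' l where al: "a = ((x, l), (x', l))" "l < lam 0" "B x' l = -1"
    using a unfolding vertical_arcs_eq by blast
  obtain y y' l' where bl: "b = ((y, l'), (y', l'))" "B y' l' = -1"
    using b unfolding vertical_arcs_eq by blast
  have "l' = l" using col al bl by simp
  then show ?thesis using column_neg_unique[OF al(2)] al bl by simp
qed

lemma kgr_verts_iff: "(i, j) \<in> verts G \<longleftrightarrow> j < lam 0 \<and> B i j \<noteq> 0"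
  using star_outside by (auto simp: kgr_graph_def kgr_verts_def)

lemma kgr_simps [simp]:
  "arcs G = horizontal_arcs r lam mu \<union> vertical_arcs r lam mu" "tail G = fst" "head G = snd"
  by (simp_all add: kgr_graph_def)

lemma kgr_arc_cases:
  assumes "(u, v) \<in> arcs G"
  obtains (horizontal) i j where "u = (i, j)" "v = (i, partner i j)" "j < lam 0" "B i j = -1"
      "partner i j < j" "B i (partner i j) = 1"
  | (vertical) i i' j where "u = (i, j)" "v = (i', j)" "j < lam 0" "B i j = 1" "B i' j = -1"
proof -
  from assms consider "(u, v) \<in> horizontal_arcs r lam mu" | "(u, v) \<in> vertical_arcs r lam mu" by auto
  then show thesis
  proof cases
    case 1
    then obtain i j where "u = (i, j)" "v = (i, partner i j)" "j < lam 0" "B i j = -1"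
      unfolding horizontal_arcs_eq by blast
    then show thesis using horizontal partner(1,2) by blast
  next
    case 2
    then show thesis unfolding vertical_arcs_eq using vertical by blast
  qed
qed

lemma horizontal_arc: "j < lam 0 \<Longrightarrow> B i j = -1 \<Longrightarrow> ((i, j), (i, partner i j)) \<in> arcs G"
  by (auto simp: horizontal_arcs_eq)

lemma vertical_arc: "j < lam 0 \<Longrightarrow> B i j = 1 \<Longrightarrow> B i' j = -1 \<Longrightarrow> ((i, j), (i', j)) \<in> vertical_arcs r lam mu"
  by (auto simp: vertical_arcs_eq)

lemma kgr_wf: "wf_digraph G"
proof
  fix e assume e: "e \<in> arcs G"
  obtain u v where [simp]: "e = (u, v)" by (cases e)
  from e have "(u, v) \<in> arcs G" by simp
  then have "u \<in> verts G \<and> v \<in> verts G"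
    by (cases rule: kgr_arc_cases) (auto simp: kgr_verts_iff)
  then show "tail G e \<in> verts G" "head G e \<in> verts G" by simp_all
qed

text \<open>Arcs out of a \<open>1\<close> end at the only \<open>-1\<close> of its column, and a
  \<open>-1\<close> has just the arc to its partner. With \<open>kgr_acyclic\<close> this makes the
  graph a forest directed towards its sinks.\<close>

lemma kgr_out_unique: "(u, v) \<in> arcs G \<Longrightarrow> (u, v') \<in> arcs G \<Longrightarrow> v = v'"
  by (elim kgr_arc_cases) (auto dest: column_neg_unique)

lemma kgr_acyclic: "acyclic (arcs G)"
proof -
  \<comment> \<open>\<open>f\<close> drops along every arc: a vertical arc loses the bonus for a
    \<open>1\<close>, and a horizontal arc gains it but moves at least one column to the
    left.\<close>
  define f where "f = (\<lambda>(i, j). 2 * j + (if B i j = 1 then 1 else 0 :: nat))"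
  have "arcs G \<subseteq> (measure f)\<inverse>"
  proof
    fix e assume "e \<in> arcs G"
    moreover obtain u v where "e = (u, v)" by (cases e)
    ultimately have "(u, v) \<in> arcs G" and "e = (u, v)" by simp_all
    from this(1) show "e \<in> (measure f)\<inverse>" unfolding \<open>e = (u, v)\<close>
      by (cases rule: kgr_arc_cases) (auto simp: f_def)
  qed
  then show ?thesis
    by (rule acyclic_subset[rotated]) (simp add: acyclic_converse wf_acyclic)
qed

section \<open>From conservative subtrees to reducing sets\<close>

text \<open>Differences of consecutive column sums are row sums of \<open>B\<close>, the last row
  giving the sum itself. Nonnegativity of the column sums follows from that of the matrix
  entries.\<close>

lemma reducible_iff:
  "reducible r (lam 0) (canonical_matrix r lam mu) \<longleftrightarrow>
    (\<exists>S. S \<subseteq> {..<lam 0} \<and> S \<noteq> {} \<and> S \<noteq> {..<lam 0}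
      \<and> (\<forall>i<r. 0 \<le> (\<Sum>j\<in>S. B i j)) \<and> (\<forall>i<r. 0 \<le> (\<Sum>j\<in>{..<lam 0} - S. B i j)))"
proof -
  have "decreasing_nonneg r (\<lambda>i. \<Sum>j\<in>S. canonical_matrix r lam mu i j)
      \<longleftrightarrow> (\<forall>i<r. 0 \<le> (\<Sum>j\<in>S. B i j))" if "S \<subseteq> {..<lam 0}" for S
  proof -
    let ?f = "\<lambda>i. \<Sum>j\<in>S. canonical_matrix r lam mu i j"
    have B: "(\<Sum>j\<in>S. B i j) = ?f i - (if Suc i < r then ?f (Suc i) else 0)" for i
      by (simp add: star_matrix_def sum_subtractf)
    have nonneg: "0 \<le> ?f i" for i
      using that by (intro sum_nonneg canonical_nonneg) auto
    show ?thesis unfolding decreasing_nonneg_def B using nonneg by (auto dest: Suc_lessD)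
  qed
  then show ?thesis unfolding reducible_def by (simp only: Diff_subset cong: conj_cong)
qed

text \<open>The matching \<open>f\<close> is left free because case (C.2) uses
  \<open>partner\<close> with two values exchanged.\<close>

lemma row_sum_nonneg:
  assumes T: "T \<subseteq> {..<lam 0}" and inj: "inj_on f {j \<in> T. B i j = -1}"
    and f: "\<And>j. j \<in> T \<Longrightarrow> B i j = -1 \<Longrightarrow> f j \<in> T \<and> B i (f j) = 1"
  shows "0 \<le> (\<Sum>j\<in>T. B i j)"
proof -
  have fin: "finite T" using T finite_subset by blast
  have "B i j = of_bool (B i j = 1) - of_bool (B i j = -1)" if "j \<in> T" for j
    using star_cases[of j i] T that by auto
  then have "(\<Sum>j\<in>T. B i j) = (\<Sum>j\<in>T. of_bool (B i j = 1) - of_bool (B i j = -1))"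
    by (rule sum.cong[OF refl])
  also have "\<dots> = int (card {j \<in> T. B i j = 1}) - int (card {j \<in> T. B i j = -1})"
    using fin by (simp add: sum_subtractf Int_def)
  finally have "(\<Sum>j\<in>T. B i j) = int (card {j \<in> T. B i j = 1}) - int (card {j \<in> T. B i j = -1})" .
  moreover have "card {j \<in> T. B i j = -1} \<le> card {j \<in> T. B i j = 1}"
    by (rule card_inj_on_le[OF inj]) (use f fin in auto)
  ultimately show ?thesis by simp
qed

lemma partner_inj_on:
  assumes "T \<subseteq> {..<lam 0}"
  shows "inj_on (partner i) {j \<in> T. B i j = -1}"
proof (rule inj_onI)
  fix x y assume "x \<in> {j \<in> T. B i j = -1}" "y \<in> {j \<in> T. B i j = -1}" "partner i x = partner i y"
  then show "x = y" using assms by (intro partner_inj[of x i y]) auto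
qed

lemma kgr_subgraph:
  assumes "subgraph H G"
  shows "tail H = fst" "head H = snd" "arcs_ends H = arcs H" "arcs H \<subseteq> arcs G" "verts H \<subseteq> verts G"
    "wf_digraph H" "\<And>u v. (u, v) \<in> arcs H \<Longrightarrow> u \<in> verts H \<and> v \<in> verts H"
proof -
  show th: "tail H = fst" "head H = snd" and "arcs H \<subseteq> arcs G" "verts H \<subseteq> verts G"
    and wf: "wf_digraph H"
    using assms by (auto simp: subgraph_def compatible_def)
  show "arcs_ends H = arcs H" by (auto simp: arcs_ends_conv th)
  show "u \<in> verts H \<and> v \<in> verts H" if "(u, v) \<in> arcs H" for u v
    using wf_digraph.tail_in_verts[OF wf that] wf_digraph.head_in_verts[OF wf that] by (simp add: th)
qed

lemma sink_iff: "subgraph H G \<Longrightarrow> sink H u \<longleftrightarrow> u \<in> verts H \<and> (\<forall>y. (u, y) \<notin> arcs H)"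
  unfolding sink_def out_arcs_def by (cases u) (auto simp: kgr_subgraph(1))

lemma source_iff: "subgraph H G \<Longrightarrow> source H u \<longleftrightarrow> u \<in> verts H \<and> (\<forall>y. (y, u) \<notin> arcs H)"
  unfolding source_def in_arcs_def by (cases u) (auto simp: kgr_subgraph(2))

lemma kgr_subgraph_refl: "subgraph G G"
  using kgr_wf by (simp add: subgraph_def compatible_def)

text \<open>A component contains all nonzero entries of a column or none, and a \<open>-1\<close>
  together with its partner. So \<open>partner\<close> matches within \<open>S\<close> and within
  its complement.\<close>

lemma reducible_if_component:
  assumes max: "pre_digraph.max_subgraph G connected H" and ne: "H \<noteq> G" and vne: "verts H \<noteq> {}"
  shows "reducible r (lam 0) (canonical_matrix r lam mu)"
proof -
  have sub: "subgraph H G" using max by (simp add: pre_digraph.max_subgraph_def)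
  note H = kgr_subgraph[OF sub]
  have closed: "u \<in> verts H \<longleftrightarrow> v \<in> verts H" if "(u, v) \<in> arcs G" for u v
    using max_connected_subgraph_closed(2,3)[OF max that] by auto
  define S where "S = {j. \<exists>i. (i, j) \<in> verts H}"
  have S: "S \<subseteq> {..<lam 0}" using H(5) by (auto simp: S_def kgr_verts_iff)
  have full: "j \<in> S \<longleftrightarrow> (i, j) \<in> verts H" if ij: "j < lam 0" "B i j \<noteq> 0" for i j
  proof
    assume "j \<in> S"
    then obtain i' where i': "(i', j) \<in> verts H" by (auto simp: S_def)
    then have b': "B i' j \<noteq> 0" using H(5) by (auto simp: kgr_verts_iff)
    show "(i, j) \<in> verts H"
    \<comment> \<open>The entries of a column are joined through its \<open>-1\<close>; a column
      without \<open>-1\<close> has a single nonzero entry.\<close>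
    proof (cases "\<exists>x. B x j = -1")
      case True
      then obtain x where x: "B x j = -1" by blast
      have "(y, j) \<in> verts H \<longleftrightarrow> (x, j) \<in> verts H" if "B y j \<noteq> 0" for y
      proof (cases "B y j = 1")
        case True
        then show ?thesis using closed vertical_arc[OF ij(1) True x] by simp
      next
        case False
        then have "y = x" using star_cases[OF ij(1), of y] that column_neg_unique[OF ij(1) _ x] by auto
        then show ?thesis by simp
      qed
      then show ?thesis using i' b' ij(2) by blast
    next
      case False
      then have "B i j = 1" "B i' j = 1" using star_cases[OF ij(1)] ij(2) b' by metis+
      then show ?thesis using column_pos_unique[OF ij(1)] False i' by metis
    qed
  qed (auto simp: S_def)
  have cl: "j \<in> S \<longleftrightarrow> partner i j \<in> S" if "j < lam 0" "B i j = -1" for i j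
    using closed[OF horizontal_arc[OF that]] full[of j i] full[of "partner i j" i] that
      partner(1,2)[OF that] by auto
  have "0 \<le> (\<Sum>j\<in>T. B i j)" if "T = S \<or> T = {..<lam 0} - S" for T i
  proof (rule row_sum_nonneg)
    show T: "T \<subseteq> {..<lam 0}" using S that by auto
    show "inj_on (partner i) {j \<in> T. B i j = -1}" using T by (rule partner_inj_on)
    fix j assume j: "j \<in> T" "B i j = -1"
    then have "j < lam 0" using T by auto
    then show "partner i j \<in> T \<and> B i (partner i j) = 1"
      using cl[of j i] partner(1,2)[of j i] j that by auto
  qed
  moreover have "S \<noteq> {}" using vne by (auto simp: S_def)
  moreover have "S \<noteq> {..<lam 0}"
  proof
    assume "S = {..<lam 0}"
    then have "verts G \<subseteq> verts H" using full by (auto simp: kgr_verts_iff)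
    then have v: "verts H = verts G" using H(5) by blast
    have "arcs G \<subseteq> arcs H"
    proof
      fix a assume "a \<in> arcs G"
      moreover have "tail G a \<in> verts H"
        using wf_digraph.tail_in_verts[OF kgr_wf \<open>a \<in> arcs G\<close>] v by simp
      ultimately show "a \<in> arcs H" using max_connected_subgraph_closed(1)[OF max] by blast
    qed
    then have "arcs H = arcs G" using H(4) by blast
    then have "H = G" using v H(1,2) by (intro pre_digraph.equality) simp_all
    with ne show False by contradiction
  qed
  ultimately show ?thesis unfolding reducible_iff using S by blast
qed

text \<open>Only \<open>v\<close> and a \<open>-1\<close> outside \<open>S\<close> with partner
  \<open>w\<close> can be separated from their partners. Both stand in the row of \<open>v\<close>,
  and exchanging their partners repairs both sides.\<close>

lemma reducible_if_pruned_tree: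
  assumes sub: "subgraph H G"
    and vert: "\<forall>a \<in> arcs H \<inter> vertical_arcs r lam mu. \<forall>b \<in> vertical_arcs r lam mu.
      snd (fst b) = snd (fst a) \<longrightarrow> b \<in> arcs H"
    and sink: "\<forall>u. sink H u \<longleftrightarrow> u = v" and v: "B (fst v) (snd v) = -1"
    and w: "source H w" "B (fst w) (snd w) = 1" "fst w = fst v"
    and source: "\<forall>u. source H u \<and> u \<noteq> w \<longrightarrow> source G u"
  shows "reducible r (lam 0) (canonical_matrix r lam mu)"
proof -
  note H = kgr_subgraph[OF sub]
  obtain iv jv jw where vw: "v = (iv, jv)" "w = (iv, jw)" using w(3) by (metis prod.collapse)
  have vH: "(iv, jv) \<in> verts H" "\<And>x. ((iv, jv), x) \<notin> arcs H"
    using sink unfolding sink_iff[OF sub] vw by blast+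
  have wH: "(iv, jw) \<in> verts H" "\<And>x. (x, (iv, jw)) \<notin> arcs H"
    using w(1) unfolding source_iff[OF sub] vw by blast+
  have Bv: "B iv jv = -1" and Bw: "B iv jw = 1" using v w(2) by (simp_all add: vw)
  have out: "\<exists>y. (u, y) \<in> arcs H" if "u \<in> verts H" "u \<noteq> (iv, jv)" for u
  proof -
    have "\<not> sink H u" using sink that(2) unfolding vw by blast
    then show ?thesis using that(1) unfolding sink_iff[OF sub] by blast
  qed
  have "in": "(\<exists>y. (y, u) \<in> arcs H)" if "u \<in> verts H" "u \<noteq> (iv, jw)" "(y, u) \<in> arcs G" for u y
  proof -
    have "\<not> source G u" unfolding source_iff[OF kgr_subgraph_refl] using that(3) by blast
    then have "\<not> source H u" using source that(2) unfolding vw by blast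
    then show ?thesis using that(1) unfolding source_iff[OF sub] by blast
  qed
  have col: "(\<exists>x. B x j = -1) \<and> (\<forall>y. B y j \<noteq> 0 \<longrightarrow> (y, j) \<in> verts H)" if ij: "(i, j) \<in> verts H" for i j
  proof -
    have j: "j < lam 0" "B i j \<noteq> 0" using ij H(5) by (auto simp: kgr_verts_iff)
    \<comment> \<open>Some vertical arc of the column lies in \<open>H\<close>: a \<open>1\<close>
      is not the sink \<open>v\<close>, so it has an arc out; a \<open>-1\<close> is not
      \<open>w\<close> and has arcs in from the \<open>1\<close>s of its column, so it is no source
      of \<open>H\<close> either. Then \<open>vert\<close> supplies the rest of the column.\<close>
    have "\<exists>y x. B y j = 1 \<and> B x j = -1 \<and> ((y, j), (x, j)) \<in> arcs H"
    proof (cases "B i j = 1")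
      case True
      then have "(i, j) \<noteq> (iv, jv)" using Bv by auto
      then obtain y where y: "((i, j), y) \<in> arcs H" using out ij by blast
      then have "((i, j), y) \<in> arcs G" using H(4) by blast
      then show ?thesis using y True by (cases rule: kgr_arc_cases) auto
    next
      case False
      then have neg: "B i j = -1" using star_cases[OF j(1), of i] j(2) by auto
      then have "(i, j) \<noteq> (iv, jw)" using Bw by auto
      moreover obtain y where "B y j = 1" using column_pos_exists[OF j(1)] by blast
      then have "((y, j), (i, j)) \<in> arcs G" using vertical_arc[OF j(1) _ neg] by simp
      ultimately obtain z where z: "(z, (i, j)) \<in> arcs H" using "in" ij by blast
      then have "(z, (i, j)) \<in> arcs G" using H(4) by blast
      then show ?thesis using z neg by (cases rule: kgr_arc_cases) auto
    qed
    then obtain y x where xy: "B y j = 1" "B x j = -1" "((y, j), (x, j)) \<in> arcs H" by blast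
    have xH: "(x, j) \<in> verts H" using H(7)[OF xy(3)] by simp
    have "(z, j) \<in> verts H" if "B z j \<noteq> 0" for z
    proof (cases "B z j = 1")
      case True
      have "((z, j), (x, j)) \<in> arcs H"
        using vert xy(3) vertical_arc[OF j(1) xy(1,2)] vertical_arc[OF j(1) True xy(2)] by fastforce
      then show ?thesis using H(7) by blast
    next
      case False
      then have "z = x" using star_cases[OF j(1), of z] that column_neg_unique[OF j(1) _ xy(2)] by auto
      then show ?thesis using xH by simp
    qed
    then show ?thesis using xy(2) by blast
  qed
  define S where "S = {j. \<exists>i. (i, j) \<in> verts H}"
  have S: "S \<subseteq> {..<lam 0}" using H(5) by (auto simp: S_def kgr_verts_iff)
  have full: "j \<in> S \<longleftrightarrow> (i, j) \<in> verts H" if "B i j \<noteq> 0" for i j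
    using col that by (auto simp: S_def)
  have jS: "jv \<in> S" "jw \<in> S" using vH(1) wH(1) by (auto simp: S_def)
  have jl: "jv < lam 0" "jw < lam 0" using jS S by auto
  have arcS: "((i, j), (i, partner i j)) \<in> arcs H" 
    if j: "j \<in> S" "B i j = -1" "(i, j) \<noteq> (iv, jv)" for i j
  proof -
    have "(i, j) \<in> verts H" using full[of i j] j by simp
    then obtain y where y: "((i, j), y) \<in> arcs H" using out j(3) by blast
    have "j < lam 0" using j(1) S by auto
    then have "y = (i, partner i j)"
      using y H(4) horizontal_arc[of j i] j(2) by (intro kgr_out_unique[of "(i, j)"]) blast+
    with y show ?thesis by simp
  qed
  have arcP: "((i, j), (i, partner i j)) \<in> arcs H"
    if j: "j < lam 0" "B i j = -1" and p: "partner i j \<in> S" "(i, partner i j) \<noteq> (iv, jw)" for i j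
  proof -
    have "(i, partner i j) \<in> verts H" using full[of i "partner i j"] partner(2)[OF j] p(1) by simp
    then obtain y where y: "(y, (i, partner i j)) \<in> arcs H"
      using "in"[OF _ p(2) horizontal_arc[OF j]] by blast
    then have "(y, (i, partner i j)) \<in> arcs G" using H(4) by blast
    then have "y = (i, j)"
      using partner(2)[OF j] partner_inj[OF j] by (cases rule: kgr_arc_cases) auto
    with y show ?thesis by simp
  qed
  have sum_S: "0 \<le> (\<Sum>j\<in>S. B i j)" for i
  proof (rule row_sum_nonneg[OF S])
    let ?f = "\<lambda>j. if (i, j) = (iv, jv) then jw else partner i j"
    have ne: "partner i j \<noteq> jw" if "j \<in> S" "B i j = -1" "(i, j) \<noteq> (iv, jv)" "i = iv" for j
      using arcS[OF that(1-3)] wH(2) that(4) by auto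
    show "inj_on ?f {j \<in> S. B i j = -1}"
    proof (rule inj_onI)
      fix x y assume "x \<in> {j \<in> S. B i j = -1}" "y \<in> {j \<in> S. B i j = -1}" "?f x = ?f y"
      then show "x = y"
        using ne[of x] ne[of y] partner_inj[of x i y] S by (auto split: if_splits)
    qed
    fix j assume j: "j \<in> S" "B i j = -1"
    show "?f j \<in> S \<and> B i (?f j) = 1"
    proof (cases "(i, j) = (iv, jv)")
      case True
      then show ?thesis using jS Bw by simp
    next
      case False
      then have "(i, partner i j) \<in> verts H" using arcS[OF j] H(7) by blast
      then show ?thesis using False partner(2)[of j i] j S by (auto simp: S_def)
    qed
  qed
  have sum_C: "0 \<le> (\<Sum>j\<in>{..<lam 0} - S. B i j)" for i
  proof (rule row_sum_nonneg[OF Diff_subset])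
    let ?f = "\<lambda>j. if (i, partner i j) = (iv, jw) then partner iv jv else partner i j"
    have ne: "partner i j \<noteq> partner iv jv" if "j < lam 0" "j \<notin> S" "B i j = -1" "i = iv" for j
      using partner_inj[of j iv jv] that jl jS Bv by auto
    show "inj_on ?f {j \<in> {..<lam 0} - S. B i j = -1}"
    proof (rule inj_onI)
      fix x y assume "x \<in> {j \<in> {..<lam 0} - S. B i j = -1}" "y \<in> {j \<in> {..<lam 0} - S. B i j = -1}"
        "?f x = ?f y"
      then show "x = y"
        using ne[of x] ne[of y] partner_inj[of x i y] by (auto split: if_splits)
    qed
    fix j assume "j \<in> {..<lam 0} - S" "B i j = -1"
    then have j: "j < lam 0" "j \<notin> S" "B i j = -1" by auto
    show "?f j \<in> {..<lam 0} - S \<and> B i (?f j) = 1"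
    proof (cases "(i, partner i j) = (iv, jw)")
      case True
      \<comment> \<open>Were the partner of \<open>v\<close> in \<open>S\<close>, it would be a
        \<open>1\<close> other than \<open>w\<close>, and \<open>arcP\<close> would give the sink
        \<open>v\<close> an arc out.\<close>
      have "partner iv jv \<noteq> jw" using ne[OF j] True by auto
      then have "partner iv jv \<notin> S" using arcP[OF jl(1) Bv] vH(2) by auto
      then show ?thesis using True partner(1,2)[OF jl(1) Bv] jl(1) by auto
    next
      case False
      have "partner i j \<notin> S"
      proof
        assume "partner i j \<in> S"
        from arcP[OF j(1,3) this False] have "(i, j) \<in> verts H" using H(7) by blast
        with j(2) show False by (auto simp: S_def)
      qed
      then show ?thesis using False partner(1,2)[OF j(1,3)] j(1) by auto
    qed
  qed
  \<comment> \<open>By \<open>col\<close> every column in \<open>S\<close> contains a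
    \<open>-1\<close>, but column \<open>0\<close> does not.\<close>
  have "0 \<notin> S"
    using col first_column_not_neg jl(1) by (auto simp: S_def)
  then have "S \<noteq> {..<lam 0}" using jl by auto
  moreover have "S \<noteq> {}" using jS by blast
  ultimately show ?thesis unfolding reducible_iff using S sum_S sum_C by blast
qed

lemma conservative_subtree_iff:
  "conservative_subtree r lam mu H \<longleftrightarrow> subgraph H G \<and> connected H \<and> verts H \<noteq> {} \<and> H \<noteq> G
     \<and> (\<forall>a \<in> arcs H \<inter> vertical_arcs r lam mu. \<forall>b \<in> vertical_arcs r lam mu.
          snd (fst b) = snd (fst a) \<longrightarrow> b \<in> arcs H)
     \<and> (pre_digraph.max_subgraph G connected H
        \<or> (\<exists>v. (\<forall>u. sink H u \<longleftrightarrow> u = v) \<and> B (fst v) (snd v) = -1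
             \<and> (\<exists>w. source H w \<and> B (fst w) (snd w) = 1 \<and> fst w = fst v
                  \<and> (\<forall>u. source H u \<and> u \<noteq> w \<longrightarrow> source G u))))"
  unfolding conservative_subtree_def Let_def kgr_simps by (rule refl)

lemma reducible_if_conservative_subtree:
  assumes "conservative_subtree r lam mu H"
  shows "reducible r (lam 0) (canonical_matrix r lam mu)"
proof (cases "pre_digraph.max_subgraph G connected H")
  case True
  then show ?thesis using assms reducible_if_component unfolding conservative_subtree_iff by blast
next
  case False
  then obtain v w where vw: "\<forall>u. sink H u \<longleftrightarrow> u = v" "B (fst v) (snd v) = -1"
    "source H w" "B (fst w) (snd w) = 1" "fst w = fst v" "\<forall>u. source H u \<and> u \<noteq> w \<longrightarrow> source G u"
    using assms unfolding conservative_subtree_iff by blast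
  have sub: "subgraph H G" and vert: "\<forall>a \<in> arcs H \<inter> vertical_arcs r lam mu. \<forall>b \<in> vertical_arcs r lam mu.
          snd (fst b) = snd (fst a) \<longrightarrow> b \<in> arcs H"
    using assms unfolding conservative_subtree_iff by blast+
  show ?thesis by (rule reducible_if_pruned_tree[OF sub vert vw])
qed

section \<open>From reducing sets to conservative subtrees\<close>

lemma partner_eqI:
  assumes c: "c < lam 0" "B x c = -1" and t: "t < c" "B x t = 1" "\<And>l. t < l \<Longrightarrow> l < c \<Longrightarrow> B x l = 0"
  shows "partner x c = t"
  using partner(1,2)[OF c] partner(3)[OF c, of t] t(1,2) t(3)[of "partner x c"]
  by (cases "partner x c" t rule: linorder_cases) auto

text \<open>This is the case \<open>K t \<le> e\<close> of \<open>column_shape\<close>. In terms of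
  tokens, those in rows \<open>a - 1\<close> and \<open>e\<close> are replaced by one in row
  \<open>x\<close>; for \<open>a = 0\<close> only the token in row \<open>e\<close> is
  removed.\<close>

lemma merging_column:
  assumes t: "t < lam 0" and neg: "\<exists>x. B x t = -1"
  obtains a e x where "a < K t" "K t \<le> e" "a \<le> x" "x < e" "B e t = 1" "B x t = -1"
    "0 < prefix (Suc t) e" "\<And>y. a \<le> y \<Longrightarrow> y < e \<Longrightarrow> prefix (Suc t) y = 0"
    "0 < a \<Longrightarrow> B (a - 1) t = 1" "0 < a \<Longrightarrow> 0 < prefix (Suc t) (a - 1)"
    "\<And>y. B y t \<noteq> 0 \<Longrightarrow> y = e \<or> y = x \<or> Suc y = a"
proof -
  obtain a e where ae: "column_shape t a e" using column_shape_exists[OF t] by blast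
  note D = column_shapeD[OF ae]
  obtain x where x: "B x t = -1" using neg by blast
  have k: "K t \<le> e" "x + K t = a + e" using x D(7)[of x] by (auto split: if_splits)
  have ax: "a \<le> x" "x < e" using k D(1) by auto
  have "B e t = 1" using D(7)[of e] by simp
  moreover have "B (a - 1) t = 1" if "0 < a" using D(7)[of "a - 1"] k that by simp
  moreover have "y = e \<or> y = x \<or> Suc y = a" if "B y t \<noteq> 0" for y
    using D(7)[of y] that k by (auto split: if_splits)
  ultimately show thesis using that[of a e x] D(1,4,5,6) k(1) ax x by blast
qed

text \<open>
  Read the columns from right to left and regard \<open>prefix t y\<close> as the number of tokens in row
  \<open>y\<close>: a merging column removes the two tokens next to position \<open>K t\<close> and puts one between them.
  The conditions below describe the row \<open>x\<close> of the token that descends from \<open>(i, j)\<close>: tokens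
  further south are in rows from \<open>E\<close> on, and tokens further north lie above the current position,
  so that a token put down without using the one in row \<open>x\<close> lands south of row \<open>E\<close>.
\<close>

definition descendant :: "nat \<Rightarrow> nat \<Rightarrow> nat \<Rightarrow> nat \<Rightarrow> nat \<Rightarrow> nat \<Rightarrow> bool" where
  "descendant i j E t x c \<longleftrightarrow> ((i, j), (x, c)) \<in> (arcs G)\<^sup>* \<and> B x c = -1 \<and> t \<le> c \<and> c \<le> j
     \<and> prefix t x = 1 \<and> (\<forall>l. t \<le> l \<and> l < c \<longrightarrow> B x l = 0)
     \<and> (\<forall>y>x. 0 < prefix t y \<longrightarrow> E \<le> y) \<and> (\<forall>y<x. 0 < prefix t y \<longrightarrow> y < K t)"

lemma descendant_start:
  assumes j: "j < lam 0" "\<exists>x. B x j = -1" and pos: "B i j = 1"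
  shows "\<exists>E x. i \<le> E \<and> descendant i j E j x j"
proof -
  obtain a e x where M: "a < K j" "K j \<le> e" "a \<le> x" "x < e" "B e j = 1" "B x j = -1"
    "0 < prefix (Suc j) e" "\<And>y. a \<le> y \<Longrightarrow> y < e \<Longrightarrow> prefix (Suc j) y = 0"
    "0 < a \<Longrightarrow> B (a - 1) j = 1" "0 < a \<Longrightarrow> 0 < prefix (Suc j) (a - 1)"
    "\<And>y. B y j \<noteq> 0 \<Longrightarrow> y = e \<or> y = x \<or> Suc y = a"
    using merging_column[OF j] by blast
  \<comment> \<open>The \<open>1\<close>s of the column are in row \<open>e\<close> and possibly row
    \<open>a - 1\<close>, so \<open>e\<close> can serve as \<open>E\<close>.\<close>
  have "i = e \<or> Suc i = a" using M(6) M(11)[of i] pos by auto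
  then have ie: "i \<le> e" using M(3,4) by auto
  have "((i, j), (x, j)) \<in> arcs G" using vertical_arc[OF j(1) pos M(6)] by simp
  moreover have "a \<le> y \<Longrightarrow> y < e \<Longrightarrow> y \<noteq> x \<Longrightarrow> prefix j y = 0" for y
    using M(8)[of y] M(11)[of y] prefix_Suc[of j y] by fastforce
  then have "e \<le> y" if "x < y" "0 < prefix j y" for y
    using that M(3) by (metis leI le_trans less_imp_le less_irrefl)
  moreover have "y < K j" if "y < x" "0 < prefix j y" for y
    using that M(1,4) \<open>\<And>y. a \<le> y \<Longrightarrow> y < e \<Longrightarrow> y \<noteq> x \<Longrightarrow> prefix j y = 0\<close>[of y] by fastforce
  ultimately have "descendant i j e j x j"
    unfolding descendant_def using M(6) prefix_neg(2)[OF j(1) M(6)] by auto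
  with ie show ?thesis by blast
qed

text \<open>If column \<open>t\<close> consumes the token in row \<open>x\<close>, the path
  continues by the horizontal arc to \<open>(x, t)\<close> and the vertical arc to the new
  \<open>-1\<close>. Otherwise the path waits, and the new token lands south of \<open>E\<close>, so
  not in row \<open>i\<close>. Hence a \<open>-1\<close> in row \<open>i\<close> can only be met on
  the path.\<close>

lemma descendant_step:
  assumes desc: "descendant i j E (Suc t) x c" and j: "j < lam 0" and iE: "i \<le> E"
    and neg: "\<exists>x. B x t = -1"
  shows "(\<exists>x' c'. descendant i j E t x' c') \<and> (B i t = -1 \<longrightarrow> ((i, j), (i, t)) \<in> (arcs G)\<^sup>*)"
proof -
  have reach: "((i, j), (x, c)) \<in> (arcs G)\<^sup>*" and xc: "B x c = -1" "Suc t \<le> c" "c \<le> j"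
    and px: "prefix (Suc t) x = 1" and z: "\<And>l. Suc t \<le> l \<Longrightarrow> l < c \<Longrightarrow> B x l = 0"
    and south: "\<And>y. x < y \<Longrightarrow> 0 < prefix (Suc t) y \<Longrightarrow> E \<le> y"
    and north: "\<And>y. y < x \<Longrightarrow> 0 < prefix (Suc t) y \<Longrightarrow> y < K (Suc t)"
    using desc unfolding descendant_def by blast+
  have tl: "t < lam 0" "c < lam 0" using xc j by auto
  have KK: "K (Suc t) \<le> K t" by (rule K_antimono) simp
  obtain a e x' where M: "a < K t" "K t \<le> e" "a \<le> x'" "x' < e" "B e t = 1" "B x' t = -1"
    "0 < prefix (Suc t) e" "\<And>y. a \<le> y \<Longrightarrow> y < e \<Longrightarrow> prefix (Suc t) y = 0"
    "0 < a \<Longrightarrow> B (a - 1) t = 1" "0 < a \<Longrightarrow> 0 < prefix (Suc t) (a - 1)"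
    "\<And>y. B y t \<noteq> 0 \<Longrightarrow> y = e \<or> y = x' \<or> Suc y = a"
    using merging_column[OF tl(1) neg] by blast
  have P: "prefix t y = prefix (Suc t) y - B y t" for y by (simp add: prefix_Suc)
  have Pe: "prefix t e = prefix (Suc t) e - 1" using P[of e] M(5) by simp
  have Px': "prefix t x' = 1" using prefix_neg(2)[OF tl(1) M(6)] .
  have P0: "prefix t y = prefix (Suc t) y" if "y \<noteq> e" "y \<noteq> x'" "Suc y \<noteq> a" for y
    using P[of y] M(11)[of y] that by auto
  have mid: "prefix t y = 0" if "a \<le> y" "y < e" "y \<noteq> x'" for y
    using P0[of y] M(8)[of y] that by auto
  have used: ?thesis if Bx: "B x t = 1" and above: "\<And>y. e \<le> y \<Longrightarrow> 0 < prefix t y \<Longrightarrow> E \<le> y"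
  proof -
    have "partner x c = t" by (rule partner_eqI) (use tl xc Bx z in auto)
    then have "((x, c), (x, t)) \<in> arcs G" using horizontal_arc[OF tl(2) xc(1)] by simp
    moreover have "((x, t), (x', t)) \<in> arcs G" using vertical_arc[OF tl(1) Bx M(6)] by simp
    ultimately have r: "((i, j), (x', t)) \<in> (arcs G)\<^sup>*" using reach by (meson rtrancl.rtrancl_into_rtrancl)
    have "E \<le> y" if "x' < y" "0 < prefix t y" for y
      using above[of y] mid[of y] that M(3) by (cases "e \<le> y") auto
    moreover have "y < K t" if "y < x'" "0 < prefix t y" for y
      using mid[of y] that M(1,4) by (cases "a \<le> y") auto
    ultimately have "descendant i j E t x' t"
      unfolding descendant_def using r M(6) xc Px' by auto
    moreover have "i = x'" if "B i t = -1" using that column_neg_unique[OF tl(1) _ M(6)] by blast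
    ultimately show ?thesis using r by blast
  qed
  have "x < a \<or> e \<le> x" using M(8)[of x] px by force
  then consider "x = e" | "e < x" | "Suc x = a" | "Suc x < a" by linarith
  then show ?thesis
  proof cases
    case 1
    show ?thesis
    proof (rule used)
      show "B x t = 1" using 1 M(5) by simp
      fix y assume y: "e \<le> y" "0 < prefix t y"
      then have "y \<noteq> e" using Pe px 1 by auto
      then have "prefix (Suc t) y = prefix t y" using y P0[of y] M(3,4) by simp
      then show "E \<le> y" using south[of y] y \<open>y \<noteq> e\<close> 1 by simp
    qed
  next
    case 2
    \<comment> \<open>The token in row \<open>e\<close> would be north of \<open>x\<close>, so
      \<open>e < K (Suc t) \<le> K t \<le> e\<close>.\<close>
    then have "e < K t" using north[OF 2 M(7)] KK by simp
    then show ?thesis using M(2) by simp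
  next
    case 3
    show ?thesis
    proof (rule used)
      show "B x t = 1" using 3 M(9) by auto
      fix y assume y: "e \<le> y" "0 < prefix t y"
      then have "0 < prefix (Suc t) y"
        using M(3,4) P0[of y] Pe by (cases "y = e") auto
      then show "E \<le> y" using south[of y] y 3 M(3,4) by simp
    qed
  next
    case 4
    \<comment> \<open>Row \<open>a - 1\<close> holds a token south of \<open>x\<close>, so
      \<open>E \<le> a - 1 < x'\<close> and the new token lies beyond row \<open>i\<close>.\<close>
    have Ea: "E \<le> a - 1" using south[of "a - 1"] M(10) 4 by simp
    have xs: "B x t = 0" using M(11)[of x] M(3,4) 4 by force
    have "prefix t x = 1" using px P[of x] xs by simp
    moreover have "B x l = 0" if "t \<le> l" "l < c" for l
      using that xs z[of l] by (cases "l = t") auto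
    moreover have "E \<le> y" if "x < y" "0 < prefix t y" for y
    proof (cases "0 < prefix (Suc t) y")
      case False
      then have "B y t < 0" using that(2) P[of y] by simp
      then have "B y t = -1" using star_cases[OF tl(1), of y] by auto
      then have "y = x'" using column_neg_unique[OF tl(1) _ M(6)] by blast
      then show ?thesis using Ea M(3) by simp
    qed (use south that in auto)
    moreover have "y < K t" if "y < x" "0 < prefix t y" for y
      using north[of y] that P0[of y] 4 M(3,4) KK by force
    ultimately have "descendant i j E t x c"
      unfolding descendant_def using reach xc by auto
    moreover have "B i t \<noteq> -1"
    proof
      assume "B i t = -1"
      then have "i = x'" using column_neg_unique[OF tl(1) _ M(6)] by blast
      then show False using Ea M(3) iE 4 by simp
    qed
    ultimately show ?thesis by blast
  qed
qed

lemma row_return_path: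
  assumes merging: "\<And>t. 0 < t \<Longrightarrow> t < lam 0 \<Longrightarrow> \<exists>x. B x t = -1"
    and j: "0 < j" "j < j'" "j' < lam 0" and B: "B i j' = 1" "B i j = -1"
  shows "((i, j'), (i, j)) \<in> (arcs G)\<^sup>*"
proof -
  obtain E x where iE: "i \<le> E" and x: "descendant i j' E j' x j'"
    using descendant_start[OF j(3) merging B(1)] j by auto
  \<comment> \<open>The descent stops at \<open>Suc j\<close>; the step at column \<open>j\<close>
    itself is taken last, where \<open>B i j = -1\<close> closes the path.\<close>
  have "\<exists>x c. descendant i j' E (Suc j) x c"
  proof (rule inc_induct[of "Suc j" j'])
    show "\<exists>x c. descendant i j' E j' x c" using x by blast
    fix t assume t: "Suc j \<le> t" "t < j'" and "\<exists>x c. descendant i j' E (Suc t) x c"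
    then obtain x c where "descendant i j' E (Suc t) x c" by blast
    from descendant_step[OF this j(3) iE merging] t j
    show "\<exists>x c. descendant i j' E t x c" by simp
  qed (use j in simp)
  then obtain x c where "descendant i j' E (Suc j) x c" by blast
  from descendant_step[OF this j(3) iE merging] j B(2) show ?thesis by simp
qed

section \<open>The pruned subtree of a directed path\<close>

lemma conservative_subtree_if_row_return:
  assumes reach: "((i, j'), (i, j)) \<in> (arcs G)\<^sup>*"
    and j: "j < lam 0" "j' < lam 0" and B: "B i j' = 1" "B i j = -1"
  shows "\<exists>H. conservative_subtree r lam mu H"
proof -
  let ?v = "(i, j)" and ?w = "(i, j')"
  \<comment> \<open>\<open>R\<close> drops the arcs into \<open>?w\<close> to make it a source;
    \<open>V\<close> consists of the vertices that still reach \<open>?v\<close>.\<close>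
  define R where "R = {(x, y) \<in> arcs G. y \<noteq> ?w}"
  define V where "V = {y. (y, ?v) \<in> R\<^sup>*}"
  define H where "H = \<lparr>verts = V, arcs = {(x, y) \<in> R. y \<in> V}, tail = fst, head = snd\<rparr>"
  \<comment> \<open>A path from \<open>?w\<close> may be restarted whenever it returns to
    \<open>?w\<close>.\<close>
  have "(?w, y) \<in> R\<^sup>*" if "(?w, y) \<in> (arcs G)\<^sup>*" for y
    using that
  proof induction
    case (step y z)
    then show ?case by (cases "z = ?w") (auto simp: R_def intro: rtrancl_into_rtrancl)
  qed simp
  then have wV: "?w \<in> V" using reach by (simp add: V_def)
  have vV: "?v \<in> V" by (simp add: V_def)
  have RV: "x \<in> V" if "(x, y) \<in> R" "y \<in> V" for x y
    using that by (auto simp: V_def intro: converse_rtrancl_into_rtrancl)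
  have RG: "R \<subseteq> arcs G" by (auto simp: R_def)
  have VG: "V \<subseteq> verts G"
  proof
    fix y assume "y \<in> V"
    then have "(y, ?v) \<in> R\<^sup>*" by (simp add: V_def)
    then show "y \<in> verts G"
    proof (cases rule: converse_rtranclE)
      case base
      then show ?thesis using j B by (simp add: kgr_verts_iff)
    next
      case (step z)
      then have "(y, z) \<in> arcs G" using RG by blast
      from wf_digraph.tail_in_verts[OF kgr_wf this] show ?thesis by simp
    qed
  qed
  have wfH: "wf_digraph H" by unfold_locales (use RV in \<open>auto simp: H_def\<close>)
  have sub: "subgraph H G"
    using VG RG kgr_wf wfH by (auto simp: subgraph_def compatible_def H_def)
  note Hs = kgr_subgraph[OF sub]
  have sink_v: "sink H u \<longleftrightarrow> u = ?v" for u
  proof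
    assume s: "sink H u"
    then have "(u, ?v) \<in> R\<^sup>*" unfolding sink_iff[OF sub] by (simp add: H_def V_def)
    then show "u = ?v"
    proof (cases rule: converse_rtranclE)
      case (step z)
      then have "(u, z) \<in> arcs H" by (auto simp: H_def V_def)
      with s show ?thesis unfolding sink_iff[OF sub] by blast
    qed simp
  next
    assume u: "u = ?v"
    have "(?v, y) \<notin> arcs H" for y
    proof
      assume "(?v, y) \<in> arcs H"
      then have "(?v, y) \<in> arcs G" "(y, ?v) \<in> R\<^sup>*" using RG by (auto simp: H_def V_def)
      then have "(?v, ?v) \<in> (arcs G)\<^sup>+"
        using rtrancl_mono[OF RG] by (meson rtrancl_into_trancl2 subsetD)
      then show False using kgr_acyclic by (simp add: acyclic_def)
    qed
    then show "sink H u" unfolding sink_iff[OF sub] u using vV by (simp add: H_def)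
  qed
  have source_w: "source H ?w" unfolding source_iff[OF sub] using wV by (simp add: H_def R_def)
  have source_G: "source G u" if "source H u" "u \<noteq> ?w" for u
  proof -
    have "u \<in> verts H" and u2: "\<And>y. (y, u) \<notin> arcs H"
      using that(1) unfolding source_iff[OF sub] by blast+
    then have u: "u \<in> V" by (simp add: H_def)
    have "(y, u) \<notin> arcs G" for y using u u2[of y] that(2) by (auto simp: H_def R_def)
    then show ?thesis unfolding source_iff[OF kgr_subgraph_refl] using u VG by blast
  qed
  have "H \<noteq> G"
  proof
    assume "H = G"
    then have "sink G ?v" using sink_v by simp
    then show False using horizontal_arc[OF j(1) B(2)] unfolding sink_iff[OF kgr_subgraph_refl] by blast
  qed
  moreover have "connected H"
  proof (rule wf_digraph.connectedI_hub[OF wfH])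
    show "?v \<in> verts H" using vV by (simp add: H_def)
    fix u assume "u \<in> verts H"
    then have "(u, ?v) \<in> R\<^sup>*" by (simp add: H_def V_def)
    then show "(u, ?v) \<in> (symcl (arcs_ends H))\<^sup>*"
    proof (induction rule: converse_rtrancl_induct)
      case (step y z)
      then have "(y, z) \<in> arcs H" by (simp add: H_def V_def)
      then have "(y, z) \<in> symcl (arcs_ends H)" by (simp add: Hs(3) symcl_def)
      then show ?case using step.IH by (rule converse_rtrancl_into_rtrancl)
    qed simp
  qed
  moreover have "b \<in> arcs H" if a: "a \<in> arcs H" "a \<in> vertical_arcs r lam mu"
    and b: "b \<in> vertical_arcs r lam mu" "snd (fst b) = snd (fst a)" for a b
  proof -
    \<comment> \<open>The vertical arcs of a column share their head, and \<open>H\<close> selects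
      arcs of \<open>G\<close> by their heads only.\<close>
    have "snd b = snd a" by (rule vertical_arcs_same_head[OF a(2) b])
    then show ?thesis using a(1) b(1) by (cases a; cases b) (auto simp: H_def R_def)
  qed
  moreover have "verts H \<noteq> {}" using vV by (auto simp: H_def)
  ultimately have "conservative_subtree r lam mu H"
    unfolding conservative_subtree_iff
    using sub sink_v source_w source_G B
    by (intro conjI disjI2 exI[of _ ?v] exI[of _ ?w]) auto
  then show ?thesis by blast
qed

text \<open>A \<open>1\<close> in a column without \<open>-1\<close> is a sink, and column
  \<open>0\<close> already provides one. As out-degrees are at most one, a connected graph cannot
  have two sinks.\<close>

lemma merging_if_connected:
  assumes conn: "connected G" and t: "0 < t" "t < lam 0"
  shows "\<exists>x. B x t = -1"
proof (rule ccontr)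
  assume no: "\<not> ?thesis"
  obtain x0 where x0: "B x0 0 = 1" using column_pos_exists[of 0] t by auto
  obtain x where x: "B x t = 1" using column_pos_exists[OF t(2)] by auto
  have v: "(x0, 0) \<in> verts G" "(x, t) \<in> verts G" using x0 x t by (auto simp: kgr_verts_iff)
  have final: "((y, l), z) \<notin> arcs G" if "B y l = 1" "\<And>y. B y l \<noteq> -1" for y l z
  proof
    assume "((y, l), z) \<in> arcs G"
    then show False by (cases rule: kgr_arc_cases) (use that in auto)
  qed
  have sink0: "((x0, 0), z) \<notin> arcs G" for z
    using final[OF x0] first_column_not_neg t by auto
  \<comment> \<open>Along an undirected walk, reaching the sink passes on to successors too: the
    only arc out of a vertex is the first arc of its path.\<close>
  have "(u, (x0, 0)) \<in> (arcs G)\<^sup>*" if "((x0, 0), u) \<in> (symcl (arcs_ends G))\<^sup>*" for u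
    using that
  proof induction
    case (step y z)
    from step.hyps(2) consider "(y, z) \<in> arcs G" | "(z, y) \<in> arcs G"
      unfolding kgr_subgraph(3)[OF kgr_subgraph_refl] symcl_def by auto
    then show ?case
    proof cases
      case 1
      from step.IH show ?thesis
      proof (cases rule: converse_rtranclE)
        case base
        then show ?thesis using sink0 1 by blast
      next
        case (step z')
        then show ?thesis using kgr_out_unique[OF 1] by blast
      qed
    next
      case 2
      then show ?thesis using step.IH by (rule converse_rtrancl_into_rtrancl)
    qed
  qed simp
  then have "((x, t), (x0, 0)) \<in> (arcs G)\<^sup>*"
    using conn v unfolding wf_digraph.connected_iff_rtrancl_symcl[OF kgr_wf] by blast
  then show False
  proof (cases rule: converse_rtranclE)
    case base
    then show False using t by simp
  next
    case (step z)
    then show False using final[OF x] no by blast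
  qed
qed

lemma conservative_subtree_if_reducible:
  assumes "reducible r (lam 0) (canonical_matrix r lam mu)"
  shows "\<exists>H. conservative_subtree r lam mu H"
proof -
  obtain S where S: "S \<subseteq> {..<lam 0}" "S \<noteq> {}" "S \<noteq> {..<lam 0}"
    "\<forall>i<r. 0 \<le> (\<Sum>j\<in>S. B i j)" "\<forall>i<r. 0 \<le> (\<Sum>j\<in>{..<lam 0} - S. B i j)"
    using assms unfolding reducible_iff by blast
  \<comment> \<open>Reducibility is symmetric in \<open>S\<close> and its complement; the side
    without column \<open>0\<close> has only merging columns when \<open>G\<close> is
    connected.\<close>
  define T where "T = (if 0 \<in> S then {..<lam 0} - S else S)"
  have T: "T \<subseteq> {..<lam 0}" "T \<noteq> {}" "0 \<notin> T" "\<And>i. i < r \<Longrightarrow> 0 \<le> (\<Sum>j\<in>T. B i j)"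
    using S by (auto simp: T_def)
  have fin: "finite T" using T(1) finite_subset by blast
  show ?thesis
  proof (cases "connected G")
    case True
    define j where "j = Min T"
    have jT: "j \<in> T" using fin T(2) by (simp add: j_def)
    then have j: "0 < j" "j < lam 0" using T(1,3) by (auto intro: gr0I)
    obtain i where i: "B i j = -1" using merging_if_connected[OF True j] by blast
    have "i < r" using star_outside[OF j(2), of i] i by simp
    then have "0 \<le> B i j + (\<Sum>l\<in>T - {j}. B i l)"
      using T(4)[OF \<open>i < r\<close>] sum.remove[OF fin jT, of "B i"] by simp
    then have "0 < (\<Sum>l\<in>T - {j}. B i l)" using i by simp
    then obtain j' where j': "j' \<in> T - {j}" "0 < B i j'"
      by (meson not_le sum_nonpos)
    have jj: "j < j'" using j'(1) fin by (auto simp: j_def order.strict_iff_order)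
    have jl: "j' < lam 0" using j'(1) T(1) by auto
    have "B i j' = 1" using star_cases[OF jl, of i] j'(2) by auto
    with row_return_path[OF merging_if_connected[OF True] j(1) jj jl _ i]
    show ?thesis by (intro conservative_subtree_if_row_return[OF _ j(2) jl _ i]) auto
  next
    case False
    have "0 < lam 0" using T(1,2) by auto
    then obtain x where "B x 0 = 1" using column_pos_exists by blast
    then have "(x, 0) \<in> verts G" using \<open>0 < lam 0\<close> by (simp add: kgr_verts_iff)
    then obtain H where H: "pre_digraph.max_subgraph G connected H" "(x, 0) \<in> verts H"
      using wf_digraph.max_connected_subgraph_exists[OF kgr_wf] by blast
    have sub: "subgraph H G" and conn: "connected H"
      using H(1) by (simp_all add: pre_digraph.max_subgraph_def)
    have "H \<noteq> G" using conn False by blast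
    moreover have "b \<in> arcs H" if a: "a \<in> arcs H" "a \<in> vertical_arcs r lam mu"
      and b: "b \<in> vertical_arcs r lam mu" "snd (fst b) = snd (fst a)" for a b
    proof -
      have "snd b \<in> verts H"
        using kgr_subgraph(7)[OF sub, of "fst a" "snd a"] a(1) vertical_arcs_same_head[OF a(2) b] by simp
      then show ?thesis using max_connected_subgraph_closed(1)[OF H(1), of b] b(1) by simp
    qed
    ultimately have "conservative_subtree r lam mu H"
      unfolding conservative_subtree_iff using sub conn H by blast
    then show ?thesis by blast
  qed
qed

end

theorem theorem3p6:
  fixes r :: nat and lam mu :: "nat \<Rightarrow> nat"
  assumes "(lam, mu) \<in> Kostka r"
  shows "reducible r (lam 0) (canonical_matrix r lam mu)
    \<longleftrightarrow> (\<exists>H. conservative_subtree r lam mu H)"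
proof -
  interpret kostka_pair r lam mu by unfold_locales (rule assms)
  show ?thesis
    using conservative_subtree_if_reducible reducible_if_conservative_subtree by blast
qed

end
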